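(* Let $(M,\mathcal T,I)$ be a triangulated connected closed surface with inversive distance $I\ge0$, and let $\bar K=(\bar K_1,\dots,\bar K_N)^T\in\mathbb R^N$ be a prescribed value. Consider the prescribed curvature flow $$r_i'(t)=(\bar K_i-K_i)\,r_i,\quad i\in V,\qquad r(0)\in\Omega .$$ Suppose $\{r(t)\mid t\in[0,T)\}$ is the unique maximal solution, with $0<T\le+\infty$. Then it can always be extended to a solution $\{r(t)\mid t\in[0,+\infty)\}$ when $T<+\infty$. Furthermore, if $\bar K$ is admissible and is realized by $\bar r$, then $r(t)$ can always be extended to a solution that converges exponentially fast to $\bar r$ as $t\to+\infty$.
   Context: $M$ is a connected closed surface with triangulation $\mathcal T=\{V,E,F\}$ (vertices, edges, faces), $V=\{1,\dots,N\}$; $\{ij\}$ denotes the edge joining $i,j$ and $\{ijk\}$ the face with vertices $i,j,k$. The inversive distance is a fixed function $I:E\to[0,+\infty)$. For $r\in\mathbb R^N_{>0}$ put $l_{ij}=\sqrt{r_i^2+r_j^2+2r_ir_jI_{ij}}$ for each edge. $\Omega\subset\mathbb R^N_{>0}$ is the set of $r$ such that for every face $\{ijk\}$ the three numbers $l_{ij},l_{jk},l_{ik}$ satisfy the three strict triangle inequalities. For $r\in\Omega$, $\theta_i^{jk}$ is the inner angle at $i$ of the Euclidean triangle with edge lengths $l_{ij},l_{jk},l_{ik}$, and $K_i(r)=2\pi-\sum_{\{ijk\}\in F}\theta_i^{jk}$ (sum over faces containing $i$), $K=(K_1,\dots,K_N)^T$. $\bar K\in\mathbb R^N$ is called admissible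 if $\bar K\in K(\Omega)=\{K(r): r\in\Omega\}$; if $\bar K=K(\bar r)$ with $\bar r\in\Omega$, one says that $\bar K$ is realized by $\bar r$. The metric $\bar r\in\Omega$ realizing an admissible $\bar K$ is unique up to a scalar multiplication. For arbitrary $r\in\mathbb R^N_{>0}$ and a face $\{ijk\}$, the generalized angles are defined by: if the strict triangle inequalities hold, $\tilde\theta_i^{jk}=\theta_i^{jk}$ (and similarly for $j,k$), the inner angle of the Euclidean triangle with these edge lengths; if $l_{jk}\ge l_{ij}+l_{ik}$, then $\tilde\theta_i^{jk}=\pi$ and $\tilde\theta_j^{ik}=\tilde\theta_k^{ij}=0$ (and similarly with the roles of $i,j,k$ permuted). The extended curvature is $\widetilde K_i=2\pi-\sum_{\{ijk\}\in F}\tilde\theta_i^{jk}$, a continuous function on $\mathbb R^N_{>0}$ extending $K_i$. The maximal solution is the one in $\Omega$, and extending it to a solution on $[0,+\infty)$ means extending it as a solution in $\mathbb R^N_{>0}$ of the extended flow $r_i'(t)=(\bar K_i-\widetilde K_i)\,r_i$. Exponentially fast convergence of $r(t)$ to $\bar r$ means $\|r(t)-\bar r\|\le Ce^{-ct}$ for all $t\ge0$, for some constants $C,c>0$.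
   Formalization: The metric realizing K̄ is unique only up to scaling and the flow preserves the product of the r_i (r(t) ≡ 2r̄ is stationary), so convergence to an arbitrary r̄ is false; the formal statement has convergence to s·r̄ for some s > 0. *)

theory Defs
  imports "HOL-Analysis.Analysis"
begin

definition closed_surface :: "'m topology \<Rightarrow> bool" where
  "closed_surface M \<longleftrightarrow>
     topspace M \<noteq> {} \<and> compact_space M \<and> Hausdorff_space M \<and>
     (\<forall>x \<in> topspace M. \<exists>U. openin M U \<and> x \<in> U \<and>
        subtopology M U homeomorphic_space (euclidean :: (real^2) topology))"

text \<open>The vertices \<open>1, \<dots>, N\<close> are the elements of a finite type \<open>'v\<close>. A face is identified with
  its set of three vertices, and the geometric realization is formed inside the standard
  simplex of \<open>real^'v\<close>. The edges are the sides of the faces.\<close>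

definition realization :: "'v::finite set set \<Rightarrow> (real^'v) set" where
  "realization F = (\<Union>f\<in>F. convex hull ((\<lambda>i. axis i 1) ` f))"

definition triangulates :: "'v::finite set set \<Rightarrow> 'm topology \<Rightarrow> bool" where
  "triangulates F M \<longleftrightarrow>
     (\<forall>f\<in>F. card f = 3) \<and> \<Union>F = UNIV \<and>
     top_of_set (realization F) homeomorphic_space M"

definition edges :: "'v set set \<Rightarrow> 'v set set" where
  "edges F = {e. card e = 2 \<and> (\<exists>f\<in>F. e \<subseteq> f)}"

definition edge_length :: "('v set \<Rightarrow> real) \<Rightarrow> real^'v::finite \<Rightarrow> 'v \<Rightarrow> 'v \<Rightarrow> real" where
  "edge_length I r i j = sqrt ((r$i)\<^sup>2 + (r$j)\<^sup>2 + 2 * (r$i) * (r$j) * I {i, j})"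

text \<open>In \<open>Omega\<close> the indices range over all orderings of the vertices of a face, so that
  all three triangle inequalities are imposed.\<close>

definition Omega :: "'v::finite set set \<Rightarrow> ('v set \<Rightarrow> real) \<Rightarrow> (real^'v) set" where
  "Omega F I = {r. (\<forall>i. 0 < r$i) \<and>
     (\<forall>i j k. {i, j, k} \<in> F \<longrightarrow>
        edge_length I r j k < edge_length I r i j + edge_length I r i k)}"

text \<open>\<open>inner_angle a b c\<close> is the angle opposite to the side of length \<open>a\<close> in a Euclidean
  triangle with side lengths \<open>a\<close>, \<open>b\<close>, \<open>c\<close>.\<close>

definition inner_angle :: "real \<Rightarrow> real \<Rightarrow> real \<Rightarrow> real" where
  "inner_angle a b c = (THE \<theta>. \<exists>A B C :: real^2.
     dist B C = a \<and> dist A C = b \<and> dist A B = c \<and>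
     \<theta> = arccos ((B - A) \<bullet> (C - A) / (norm (B - A) * norm (C - A))))"

lemma inner_angle_law_of_cosines:
  assumes "a < b + c" "b < a + c" "c < a + b"
  shows "inner_angle a b c = arccos ((b\<^sup>2 + c\<^sup>2 - a\<^sup>2) / (2 * b * c))"
proof -
  have pos: "a > 0" "b > 0" "c > 0"
    using assms by auto
  have cosines: "(B - A) \<bullet> (C - A) / (norm (B - A) * norm (C - A)) =
      (b\<^sup>2 + c\<^sup>2 - a\<^sup>2) / (2 * b * c)"
    if "dist B C = a" "dist A C = b" "dist A B = c" for A B C :: "real^2"
  proof -
    have n: "norm (B - A) = c" "norm (C - A) = b" "norm ((B - A) - (C - A)) = a"
      using that by (auto simp: dist_norm norm_minus_commute)
    have "2 * ((B - A) \<bullet> (C - A)) = c\<^sup>2 + b\<^sup>2 - a\<^sup>2"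
      using dot_norm_neg[of "B - A" "C - A"] n by simp
    then show ?thesis
      using n pos by (simp add: field_simps)
  qed
  define x where "x = (b\<^sup>2 + c\<^sup>2 - a\<^sup>2) / (2 * c)"
  have cx: "2 * c * x = b\<^sup>2 + c\<^sup>2 - a\<^sup>2"
    using pos by (simp add: x_def)
  have "\<bar>x\<bar> \<le> b"
  proof -
    have "a\<^sup>2 \<le> (b + c)\<^sup>2" "(b - c)\<^sup>2 \<le> a\<^sup>2"
      using assms pos by (auto intro!: power_mono simp: abs_le_square_iff[symmetric])
    then have "(2 * c) * x \<le> (2 * c) * b" "(2 * c) * (- b) \<le> (2 * c) * x"
      unfolding cx by (auto simp: power2_eq_square algebra_simps)
    then have "x \<le> b" "- b \<le> x"
      using pos by (simp_all only: mult_le_cancel_left_pos zero_less_mult_iff zero_less_numeral simp_thms)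
    then show ?thesis
      by (simp add: abs_le_iff)
  qed
  then have xb: "x\<^sup>2 \<le> b\<^sup>2"
    using abs_le_square_iff[of x b] pos by simp
  define B C :: "real^2" where "B = vector [c, 0]" and "C = vector [x, sqrt (b\<^sup>2 - x\<^sup>2)]"
  have "dist B C = a"
  proof -
    have "(c - x)\<^sup>2 + (b\<^sup>2 - x\<^sup>2) = a\<^sup>2"
      using cx by (simp add: power2_eq_square algebra_simps)
    then show ?thesis
      using xb pos by (simp add: B_def C_def dist_norm norm_eq_sqrt_inner inner_vec_def sum_2
          power2_eq_square[symmetric])
  qed
  moreover have "dist 0 C = b" "dist 0 B = c"
    using xb pos by (simp_all add: B_def C_def dist_norm norm_eq_sqrt_inner inner_vec_def sum_2
        power2_eq_square[symmetric])
  ultimately show ?thesis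
    unfolding inner_angle_def using cosines
    by (intro the_equality) metis+
qed

definition generalized_angle :: "real \<Rightarrow> real \<Rightarrow> real \<Rightarrow> real" where
  "generalized_angle a b c =
     (if a < b + c \<and> b < a + c \<and> c < a + b then inner_angle a b c
      else if b + c \<le> a then pi
      else 0)"

text \<open>In the sums below every face containing \<open>i\<close> occurs twice, as \<open>{i, j, k}\<close> and as
  \<open>{i, k, j}\<close>; this explains the factor \<open>1 / 2\<close>.\<close>

definition curvature :: "'v::finite set set \<Rightarrow> ('v set \<Rightarrow> real) \<Rightarrow> real^'v \<Rightarrow> real^'v" where
  "curvature F I r = (\<chi> i. 2 * pi - 1 / 2 *
     (\<Sum>(j, k) \<in> {(j, k). {i, j, k} \<in> F}.
        inner_angle (edge_length I r j k) (edge_length I r i j) (edge_length I r i k)))"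

definition extended_curvature :: "'v::finite set set \<Rightarrow> ('v set \<Rightarrow> real) \<Rightarrow> real^'v \<Rightarrow> real^'v" where
  "extended_curvature F I r = (\<chi> i. 2 * pi - 1 / 2 *
     (\<Sum>(j, k) \<in> {(j, k). {i, j, k} \<in> F}.
        generalized_angle (edge_length I r j k) (edge_length I r i j) (edge_length I r i k)))"

definition time_interval :: "ereal \<Rightarrow> real set" where
  "time_interval T = {t. 0 \<le> t \<and> ereal t < T}"

definition flow_solution ::
  "(real^'v::finite \<Rightarrow> real^'v) \<Rightarrow> (real^'v) set \<Rightarrow> real^'v \<Rightarrow> ereal \<Rightarrow> (real \<Rightarrow> real^'v) \<Rightarrow> bool" where
  "flow_solution K D Kbar T r \<longleftrightarrow>
     (\<forall>t \<in> time_interval T. r t \<in> D \<and>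
        (r has_vector_derivative (\<chi> i. (Kbar$i - K (r t)$i) * r t$i)) (at t within time_interval T))"

definition maximal_flow_solution ::
  "(real^'v::finite \<Rightarrow> real^'v) \<Rightarrow> (real^'v) set \<Rightarrow> real^'v \<Rightarrow> ereal \<Rightarrow> (real \<Rightarrow> real^'v) \<Rightarrow> bool" where
  "maximal_flow_solution K D Kbar T r \<longleftrightarrow>
     flow_solution K D Kbar T r \<and>
     \<not> (\<exists>T' \<rho>. T < T' \<and> flow_solution K D Kbar T' \<rho> \<and> (\<forall>t \<in> time_interval T. \<rho> t = r t))"

definition extended_flow_solution ::
  "'v::finite set set \<Rightarrow> ('v set \<Rightarrow> real) \<Rightarrow> real^'v \<Rightarrow> (real \<Rightarrow> real^'v) \<Rightarrow> bool" where
  "extended_flow_solution F I Kbar \<rho> \<longleftrightarrow>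
     flow_solution (extended_curvature F I) {r. \<forall>i. 0 < r$i} Kbar \<infinity> \<rho>"

definition converges_exponentially :: "(real \<Rightarrow> 'a::real_normed_vector) \<Rightarrow> 'a \<Rightarrow> bool" where
  "converges_exponentially \<rho> x \<longleftrightarrow>
     (\<exists>C > 0. \<exists>c > 0. \<forall>t \<ge> 0. norm (\<rho> t - x) \<le> C * exp (- c * t))"

end

theory Submission
  imports Defs
begin

text \<open>In the logarithmic coordinates \<open>u\<^sub>i = ln r\<^sub>i\<close> the extended flow reads \<open>u' = Kbar - K u\<close>, where \<open>K\<close> is
the extended curvature as a function of \<open>u\<close>. This \<open>K\<close> is bounded and continuous, and the whole
proof rests on its monotonicity, \<open>(u - v) \<bullet> (K u - K v) \<ge> 0\<close> for all \<open>u\<close> and \<open>v\<close>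
(\<open>log_curvature_monotone\<close>). The angles are not Lipschitz where triangles degenerate, but for a
monotone field the Euler polygons still converge, so that solutions exist for all time
(\<open>monotone_flow_exists\<close>), and the distance of two solutions never grows. The global solution
that starts at \<open>r 0\<close> therefore agrees with \<open>r\<close> as long as \<open>r\<close> is defined, because the two
curvatures coincide on \<open>Omega\<close>. This is the extension.

Monotonicity is a matter of a single triangle. Along a line in direction \<open>w\<close> the sum
\<open>w\<^sub>1 \<theta>\<^sub>1 + w\<^sub>2 \<theta>\<^sub>2 + w\<^sub>3 \<theta>\<^sub>3\<close> has a nonpositive derivative while the triangle is nondegenerate
(\<open>weighted_angles_has_derivative\<close>, \<open>dissipation_pos\<close>). While it is degenerate every angle is \<open>0\<close>
or \<open>\<pi>\<close>, so the sum has finitely many possible values, and a continuous function cannot gain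
height on such a set (\<open>nonincreasing_off_finite_values\<close>).

Suppose now that \<open>Kbar = K v\<close> with \<open>v\<close> nondegenerate. The angles of a triangle add up to \<open>\<pi>\<close>, so
the sum of the coordinates is constant along the flow, and scaling moves \<open>v\<close> to the hyperplane
that contains the solution. For \<open>w = u - v\<close> one has
\<open>(\<bar>w\<bar>\<^sup>2)' = - 2 w \<bullet> (K (v + w) - K v)\<close>. Near \<open>v\<close> the right-hand side is at most \<open>- 2 c \<bar>w\<bar>\<^sup>2\<close>,
since the derivative of \<open>K\<close> vanishes only on directions that are constant on every face, and on a
connected surface these are constant. Monotonicity along rays carries this estimate to bounded
sets with a smaller \<open>c\<close> (\<open>coercive\<close>), and \<open>\<bar>w\<bar>\<close> decays exponentially.\<close>

section \<open>Flows of bounded monotone fields\<close>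

definition euler :: "('a::real_vector \<Rightarrow> 'a) \<Rightarrow> 'a \<Rightarrow> real \<Rightarrow> nat \<Rightarrow> 'a" where
  "euler X a h k = ((\<lambda>x. x + h *\<^sub>R X x) ^^ k) a"

lemma euler_0 [simp]: "euler X a h 0 = a"
  by (simp add: euler_def)

lemma euler_Suc: "euler X a h (Suc k) = euler X a h k + h *\<^sub>R X (euler X a h k)"
  by (simp add: euler_def)

text \<open>The discrete form of the mean value inequality: the increment of an Euler polygon is close to
\<open>v\<close> times the elapsed time if the field is close to \<open>v\<close> at the nodes. It yields the bound
\<open>euler_lipschitz\<close> for \<open>v = 0\<close> and the differential equation in the limit.\<close>

lemma euler_chord:
  fixes X :: "'a::real_normed_vector \<Rightarrow> 'a"
  assumes "0 \<le> h" "l \<le> m"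
    and "\<And>k. l \<le> k \<Longrightarrow> k < m \<Longrightarrow> norm (X (euler X a h k) - v) \<le> e"
  shows "norm (euler X a h m - euler X a h l - (real (m - l) * h) *\<^sub>R v) \<le> e * (real (m - l) * h)"
  using assms(2,3)
proof (induction m rule: dec_induct)
  case (step n)
  have "euler X a h (Suc n) - euler X a h l - (real (Suc n - l) * h) *\<^sub>R v
      = (euler X a h n - euler X a h l - (real (n - l) * h) *\<^sub>R v) + h *\<^sub>R (X (euler X a h n) - v)"
    using step.hyps by (simp add: euler_Suc Suc_diff_le algebra_simps)
  also have "norm \<dots> \<le> e * (real (n - l) * h) + h * e"
  proof (rule norm_triangle_le[OF add_mono])
    show "norm (euler X a h n - euler X a h l - (real (n - l) * h) *\<^sub>R v) \<le> e * (real (n - l) * h)"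
      using step by simp
    show "norm (h *\<^sub>R (X (euler X a h n) - v)) \<le> h * e"
      using step \<open>0 \<le> h\<close> by (simp add: mult_left_mono)
  qed
  also have "\<dots> = e * (real (Suc n - l) * h)"
    using step.hyps by (simp add: Suc_diff_le algebra_simps)
  finally show ?case .
qed simp

lemma euler_lipschitz:
  fixes X :: "'a::real_normed_vector \<Rightarrow> 'a"
  assumes "0 \<le> h" and B: "\<And>x. norm (X x) \<le> B"
  shows "norm (euler X a h m - euler X a h l) \<le> B * (\<bar>real m - real l\<bar> * h)"
proof -
  have le: "norm (euler X a h m - euler X a h l) \<le> B * (\<bar>real m - real l\<bar> * h)" if "l \<le> m" for l m
    using euler_chord[of h l m X a 0 B] that assms by (simp add: of_nat_diff)
  show ?thesis
    using le[of l m] le[of m l] by (cases "l \<le> m") (auto simp: norm_minus_commute abs_minus_commute)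
qed

text \<open>Each of the two half steps evaluates the field within distance \<open>B h\<close> of the points being
compared. Replacing the argument there costs \<open>O(h\<^sup>2)\<close>, and what remains has the sign given by
monotonicity. Thus a step enlarges the squared distance by \<open>O(h\<^sup>2)\<close> and nothing of order \<open>h\<close>,
although no modulus of continuity of the field is available.\<close>

lemma euler_halve_step:
  fixes X :: "'a::real_inner \<Rightarrow> 'a" and u v v' :: 'a
  assumes B: "\<And>x. norm (X x) \<le> B"
    and mono: "\<And>x y. (x - y) \<bullet> (X x - X y) \<le> 0"
    and "0 \<le> h"
  defines "v' \<equiv> v + (h/2) *\<^sub>R X v"
  shows "(norm ((u + h *\<^sub>R X u) - (v' + (h/2) *\<^sub>R X v')))\<^sup>2 \<le> (norm (u - v))\<^sup>2 + 5 * B\<^sup>2 * h\<^sup>2"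
proof -
  define d where "d = u - v"
  define p where "p = X u - X v"
  define q where "q = X u - X v'"
  have diff_le: "norm (X x - X y) \<le> 2 * B" for x y
    using norm_triangle_ineq4[of "X x" "X y"] B[of x] B[of y] by linarith
  have B0: "0 \<le> B" using B[of u] norm_ge_zero order_trans by blast
  have eq: "(u + h *\<^sub>R X u) - (v' + (h/2) *\<^sub>R X v') = d + (h/2) *\<^sub>R (p + q)"
    by (simp add: v'_def d_def p_def q_def algebra_simps flip: scaleR_add_left)
  have "d \<bullet> q = (u - v') \<bullet> q + (h/2) * (X v \<bullet> q)"
    by (simp add: d_def v'_def algebra_simps)
  also have "\<dots> \<le> 0 + (h/2) * (B * (2 * B))"
  proof (intro add_mono mult_left_mono)
    show "(u - v') \<bullet> q \<le> 0" using mono by (simp add: q_def)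
    show "X v \<bullet> q \<le> B * (2 * B)"
      using norm_cauchy_schwarz[of "X v" q] mult_mono[OF B[of v] diff_le[of u v']] B0
      by (simp add: q_def)
  qed (use \<open>0 \<le> h\<close> in auto)
  finally have dq: "d \<bullet> q \<le> B\<^sup>2 * h" by (simp add: power2_eq_square mult_ac)
  have dp: "d \<bullet> p \<le> 0" using mono by (simp add: d_def p_def)
  have "norm (p + q) \<le> 4 * B"
    using norm_triangle_ineq[of p q] diff_le[of u v] diff_le[of u v'] by (simp add: p_def q_def)
  then have pq: "(norm (p + q))\<^sup>2 \<le> (4 * B)\<^sup>2" by (intro power_mono) auto
  have "(norm (d + (h/2) *\<^sub>R (p + q)))\<^sup>2 = (norm d)\<^sup>2 + h * (d \<bullet> p) + h * (d \<bullet> q) + (h/2)\<^sup>2 * (norm (p + q))\<^sup>2"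
    unfolding power2_norm_eq_inner by (simp add: inner_add inner_commute algebra_simps power2_eq_square)
  also have "\<dots> \<le> (norm d)\<^sup>2 + h * 0 + h * (B\<^sup>2 * h) + (h/2)\<^sup>2 * (4 * B)\<^sup>2"
    using dp dq pq \<open>0 \<le> h\<close> by (intro add_mono mult_left_mono) auto
  also have "\<dots> = (norm d)\<^sup>2 + 5 * B\<^sup>2 * h\<^sup>2" by (simp add: power2_eq_square algebra_simps)
  finally show ?thesis unfolding eq d_def .
qed

text \<open>Since the errors of the steps add up only in the squared distance, over a time \<open>h k\<close> it is
\<open>O(h)\<close>, and the polygons differ by \<open>O(sqrt h)\<close>. For \<open>h = 2\<^sup>-\<^sup>n\<close> this is summable.\<close>

lemma euler_halve:
  fixes X :: "'a::real_inner \<Rightarrow> 'a"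
  assumes B: "\<And>x. norm (X x) \<le> B"
    and mono: "\<And>x y. (x - y) \<bullet> (X x - X y) \<le> 0"
    and "0 \<le> h"
  shows "(norm (euler X a h k - euler X a (h/2) (2 * k)))\<^sup>2 \<le> 5 * B\<^sup>2 * h\<^sup>2 * real k"
proof (induction k)
  case (Suc k)
  have "(norm (euler X a h (Suc k) - euler X a (h/2) (2 * Suc k)))\<^sup>2
      \<le> (norm (euler X a h k - euler X a (h/2) (2 * k)))\<^sup>2 + 5 * B\<^sup>2 * h\<^sup>2"
    using euler_halve_step[OF B mono \<open>0 \<le> h\<close>] by (simp add: euler_Suc)
  with Suc show ?case by (simp add: algebra_simps)
qed simp

lemma convergent_if_geometric_steps:
  fixes f :: "nat \<Rightarrow> 'a::banach"
  assumes "\<And>n. norm (f (Suc n) - f n) \<le> C * q ^ n" "0 \<le> q" "q < 1"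
  shows "convergent f"
proof -
  have "summable (\<lambda>n. C * q ^ n)"
    using assms by (intro summable_mult summable_geometric) auto
  then have "summable (\<lambda>n. f (Suc n) - f n)"
    using assms(1) by (rule summable_comparison_test')
  then have "convergent (\<lambda>n. \<Sum>i<n. f (Suc i) - f i)"
    by (simp add: summable_iff_convergent)
  then have "convergent (\<lambda>n. f n - f 0)"
    by (simp add: sum_lessThan_telescope)
  then show ?thesis
    by (simp add: convergent_diff_const_right_iff)
qed

text \<open>Global existence in positive time for a bounded continuous field with \<open>(x - y) \<bullet> (X x - X y) \<le> 0\<close>.
The values at time \<open>t\<close> of the Euler polygons with step \<open>2\<^sup>-\<^sup>n\<close> form a Cauchy sequence by
\<open>euler_halve\<close>. The limit satisfies the equation because \<open>euler_chord\<close> compares increments over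
short times with the field at the limit point and passes to the limit.\<close>

theorem monotone_flow_exists:
  fixes X :: "'a::{real_inner, banach} \<Rightarrow> 'a"
  assumes cont: "continuous_on UNIV X"
    and B: "\<And>x. norm (X x) \<le> B"
    and mono: "\<And>x y. (x - y) \<bullet> (X x - X y) \<le> 0"
  obtains u where "u 0 = a"
    and "\<And>t. 0 \<le> t \<Longrightarrow> (u has_vector_derivative X (u t)) (at t within {0..})"
proof -
  define h :: "nat \<Rightarrow> real" where "h n = 1 / 2 ^ n" for n
  \<comment> \<open>The number of the last node at or before time \<open>t\<close>; halving the step doubles it up to one.\<close>
  define N where "N n t = nat \<lfloor>t * 2 ^ n\<rfloor>" for n :: nat and t :: real
  define x where "x n k = euler X a (h n) k" for n k
  have h0: "0 < h n" for n by (simp add: h_def)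
  have hS: "h (Suc n) = h n / 2" for n by (simp add: h_def)
  have h_lim: "h \<longlonglongrightarrow> 0"
    using LIMSEQ_realpow_zero[of "1/2"] by (simp add: h_def[abs_def] power_one_over)
  have B0: "0 \<le> B" using B[of a] norm_ge_zero order_trans by blast
  have N_bounds: "t - h n \<le> real (N n t) * h n" "real (N n t) * h n \<le> t" if "0 \<le> t" for n t
  proof -
    have "real (N n t) = of_int \<lfloor>t * 2 ^ n\<rfloor>"
      using that by (simp add: N_def)
    moreover have "t * 2 ^ n - 1 \<le> of_int \<lfloor>t * 2 ^ n\<rfloor>" "of_int \<lfloor>t * 2 ^ n\<rfloor> \<le> t * 2 ^ n"
      by linarith+
    ultimately have "t * 2 ^ n \<le> real (N n t) + 1" "real (N n t) \<le> t * 2 ^ n"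
      by linarith+
    then have "(t * 2 ^ n) / 2 ^ n \<le> (real (N n t) + 1) / 2 ^ n"
        "real (N n t) / 2 ^ n \<le> (t * 2 ^ n) / 2 ^ n"
      by - (rule divide_right_mono, assumption, simp)+
    then show "t - h n \<le> real (N n t) * h n" "real (N n t) * h n \<le> t"
      by (simp_all add: h_def add_divide_distrib)
  qed
  have N_lim: "(\<lambda>n. real (N n t) * h n) \<longlonglongrightarrow> t" if "0 \<le> t" for t
    by (rule tendsto_sandwich[of "\<lambda>n. t - h n" _ _ "\<lambda>n. t"])
      (use N_bounds that tendsto_diff[OF tendsto_const h_lim, of t] in auto)
  have N_double: "\<bar>real (N (Suc n) t) - real (2 * N n t)\<bar> \<le> 1" if "0 \<le> t" for n t
  proof -
    have "\<bar>\<lfloor>2 * y\<rfloor> - 2 * \<lfloor>y\<rfloor>\<bar> \<le> 1" for y :: real by linarith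
    from this[of "t * 2 ^ n"] have "\<bar>\<lfloor>t * 2 ^ Suc n\<rfloor> - 2 * \<lfloor>t * 2 ^ n\<rfloor>\<bar> \<le> 1"
      by (simp add: mult_ac)
    moreover have "real (N m t) = of_int \<lfloor>t * 2 ^ m\<rfloor>" for m
      using that by (simp add: N_def)
    ultimately show ?thesis by simp
  qed
  have conv: "convergent (\<lambda>n. x n (N n t))" if "0 \<le> t" for t
  proof (rule convergent_if_geometric_steps[where q = "sqrt (1/2)"])
    fix n
    have "norm (x n (N n t) - x (Suc n) (2 * N n t)) \<le> sqrt (5 * B\<^sup>2 * t) * sqrt (1/2) ^ n"
    proof -
      have "(norm (x n (N n t) - x (Suc n) (2 * N n t)))\<^sup>2 \<le> 5 * B\<^sup>2 * (h n)\<^sup>2 * real (N n t)"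
        unfolding x_def hS using euler_halve[OF B mono] h0[of n] by simp
      also have "\<dots> = 5 * B\<^sup>2 * (real (N n t) * h n) * h n"
        by (simp add: power2_eq_square)
      also have "\<dots> \<le> 5 * B\<^sup>2 * t * h n"
        using N_bounds[OF that] h0[of n] that by (intro mult_mono) auto
      finally have "norm (x n (N n t) - x (Suc n) (2 * N n t)) \<le> sqrt (5 * B\<^sup>2 * t * h n)"
        using real_le_rsqrt by blast
      then show ?thesis
        by (simp add: real_sqrt_mult h_def real_sqrt_divide real_sqrt_power power_divide)
    qed
    moreover have "norm (x (Suc n) (N (Suc n) t) - x (Suc n) (2 * N n t)) \<le> B * sqrt (1/2) ^ n"
    proof -
      have "norm (x (Suc n) (N (Suc n) t) - x (Suc n) (2 * N n t)) \<le> B * (1 * h (Suc n))"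
        unfolding x_def
        by (rule order_trans[OF euler_lipschitz mult_left_mono[OF mult_right_mono[OF N_double]]])
          (use h0[of "Suc n"] B B0 that in auto)
      also have "h (Suc n) \<le> sqrt (1/2) ^ n"
      proof -
        have "(1/2::real) \<le> sqrt (1/2)" by (rule real_le_rsqrt) (simp add: power2_eq_square)
        then have "(1/2::real) ^ n \<le> sqrt (1/2) ^ n" by (intro power_mono) auto
        moreover have "h (Suc n) \<le> (1/2) ^ n" by (simp add: h_def power_one_over field_simps)
        ultimately show ?thesis by linarith
      qed
      finally show ?thesis using B0 by (simp add: mult_left_mono)
    qed
    ultimately show "norm (x (Suc n) (N (Suc n) t) - x n (N n t))
        \<le> (sqrt (5 * B\<^sup>2 * t) + B) * sqrt (1/2) ^ n"
      using norm_triangle_ineq4[of "x (Suc n) (N (Suc n) t) - x (Suc n) (2 * N n t)"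
          "x n (N n t) - x (Suc n) (2 * N n t)"]
      by (simp add: algebra_simps)
  qed auto
  define u where "u t = lim (\<lambda>n. x n (N n t))" for t
  have u_lim: "(\<lambda>n. x n (N n t)) \<longlonglongrightarrow> u t" if "0 \<le> t" for t
    using conv[OF that] by (simp add: u_def convergent_LIMSEQ_iff)
  have "u 0 = a"
    by (simp add: u_def N_def x_def)
  moreover have "(u has_vector_derivative X (u t)) (at t within {0..})" if t: "0 \<le> t" for t
    unfolding has_vector_derivative_def has_derivative_within_alt
  proof (intro conjI allI impI)
    show "bounded_linear (\<lambda>s. s *\<^sub>R X (u t))" by (rule bounded_linear_scaleR_left)
    fix e :: real assume "0 < e"
    obtain \<delta> where \<delta>: "0 < \<delta>" "\<And>y. dist y (u t) < \<delta> \<Longrightarrow> dist (X y) (X (u t)) < e"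
      using cont \<open>0 < e\<close> unfolding continuous_on_iff by (meson UNIV_I)
    \<comment> \<open>Within time \<open>r\<close> the polygons move by at most \<open>\<delta> / 2\<close>; adding \<open>1\<close> covers \<open>B = 0\<close>.\<close>
    define r where "r = \<delta> / (2 * (B + 1))"
    have r: "0 < r" "B * r \<le> \<delta> / 2"
      using \<delta>(1) B0 by (auto simp: r_def field_simps)
    have "norm (u s - u t - (s - t) *\<^sub>R X (u t)) \<le> e * norm (s - t)"
      if s: "s \<in> {0..}" "norm (s - t) < r" for s
    proof -
      have s0: "0 \<le> s" using s by simp
      have "(\<lambda>n. norm (x n (N n t) - u t) + B * (2 * h n)) \<longlonglongrightarrow> norm (u t - u t) + B * (2 * 0)"
        by (intro tendsto_intros u_lim t h_lim)
      then have ev: "eventually (\<lambda>n. norm (x n (N n t) - u t) + B * (2 * h n) < \<delta> / 2) sequentially"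
        using \<delta>(1) by (auto dest!: order_tendstoD(2)[where a = "\<delta>/2"])
      have "eventually (\<lambda>n. norm (x n (N n s) - x n (N n t) - (real (N n s) * h n - real (N n t) * h n) *\<^sub>R X (u t))
          \<le> e * \<bar>real (N n s) * h n - real (N n t) * h n\<bar>) sequentially"
        using ev
      proof eventually_elim
        case (elim n)
        have close: "norm (X (x n k) - X (u t)) \<le> e"
          if "min (N n s) (N n t) \<le> k" "k \<le> max (N n s) (N n t)" for k
        proof -
          have "\<bar>real k - real (N n t)\<bar> * h n \<le> \<bar>real (N n s) - real (N n t)\<bar> * h n"
            using that h0[of n] by (intro mult_right_mono) linarith+
          also have "\<dots> = \<bar>real (N n s) * h n - real (N n t) * h n\<bar>"
            using h0[of n] by (simp add: abs_mult flip: left_diff_distrib)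
          also have "\<dots> \<le> \<bar>s - t\<bar> + 2 * h n"
            using N_bounds[OF s0, of n] N_bounds[OF t, of n] h0[of n] by linarith
          also have "\<dots> \<le> r + 2 * h n" using s by simp
          finally have "norm (x n k - x n (N n t)) \<le> B * (r + 2 * h n)"
            unfolding x_def using euler_lipschitz[OF less_imp_le[OF h0] B]
            by (meson B0 mult_left_mono order_trans)
          then have "norm (x n k - x n (N n t)) + norm (x n (N n t) - u t) < \<delta>"
            using elim r by (simp add: algebra_simps)
          then have "dist (x n k) (u t) < \<delta>"
            using norm_triangle_ineq[of "x n k - x n (N n t)" "x n (N n t) - u t"]
            by (simp add: dist_norm)
          then show ?thesis
            using \<delta>(2)[of "x n k"] by (simp add: dist_norm)
        qed
        show ?case
        proof (cases "N n t \<le> N n s")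
          case True
          then show ?thesis
            using euler_chord[OF less_imp_le[OF h0[of n]] True, of X a "X (u t)" e] close h0[of n]
            by (simp add: x_def of_nat_diff left_diff_distrib mult_right_mono)
        next
          case False
          then have le: "N n s \<le> N n t" by simp
          have "x n (N n s) - x n (N n t) - (real (N n s) * h n - real (N n t) * h n) *\<^sub>R X (u t)
             = - (x n (N n t) - x n (N n s) - (real (N n t - N n s) * h n) *\<^sub>R X (u t))"
            using le by (simp add: of_nat_diff algebra_simps)
          moreover have "\<bar>real (N n s) * h n - real (N n t) * h n\<bar> = real (N n t - N n s) * h n"
            using le h0[of n] by (simp add: of_nat_diff left_diff_distrib mult_right_mono)
          moreover have "norm (x n (N n t) - x n (N n s) - (real (N n t - N n s) * h n) *\<^sub>R X (u t))
              \<le> e * (real (N n t - N n s) * h n)"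
            unfolding x_def
          proof (rule euler_chord[OF less_imp_le[OF h0] le])
            fix k assume "N n s \<le> k" "k < N n t"
            then show "norm (X (euler X a (h n) k) - X (u t)) \<le> e"
              using close[of k] le by (simp add: x_def)
          qed
          ultimately show ?thesis by (simp only: norm_minus_cancel)
        qed
      qed
      moreover have "(\<lambda>n. norm (x n (N n s) - x n (N n t) - (real (N n s) * h n - real (N n t) * h n) *\<^sub>R X (u t)))
          \<longlonglongrightarrow> norm (u s - u t - (s - t) *\<^sub>R X (u t))"
        by (intro tendsto_intros u_lim N_lim t s0)
      moreover have "(\<lambda>n. e * \<bar>real (N n s) * h n - real (N n t) * h n\<bar>) \<longlonglongrightarrow> e * \<bar>s - t\<bar>"
        by (intro tendsto_intros N_lim t s0)
      ultimately show ?thesis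
        unfolding real_norm_def by (intro tendsto_le[OF sequentially_bot])
    qed
    then show "\<exists>d>0. \<forall>y\<in>{0..}. norm (y - t) < d \<longrightarrow>
        norm (u y - u t - (y - t) *\<^sub>R X (u t)) \<le> e * norm (y - t)"
      using r by blast
  qed
  ultimately show thesis by (rule that)
qed

lemma has_derivative_norm_sq:
  fixes f :: "real \<Rightarrow> 'a::real_inner"
  assumes "(f has_vector_derivative f') (at t within S)"
  shows "((\<lambda>t. (norm (f t))\<^sup>2) has_real_derivative 2 * (f t \<bullet> f')) (at t within S)"
  using bounded_bilinear.has_vector_derivative[OF bounded_bilinear_inner assms assms]
  by (simp add: has_real_derivative_iff_has_vector_derivative power2_norm_eq_inner inner_commute)

text \<open>A form of Gronwall's inequality: the product of \<open>\<phi> t\<close> and \<open>exp (c * t)\<close> does not increase. With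
\<open>c = 0\<close> it says that \<open>\<phi>\<close> itself does not increase.\<close>

lemma exponential_decay:
  fixes \<phi> :: "real \<Rightarrow> real"
  assumes "\<And>t. t \<in> S \<Longrightarrow> (\<phi> has_real_derivative \<phi>' t) (at t within S)"
    and "\<And>t. t \<in> S \<Longrightarrow> \<phi>' t \<le> - c * \<phi> t"
    and "{0..t} \<subseteq> S" "0 \<le> t"
  shows "\<phi> t \<le> \<phi> 0 * exp (- c * t)"
proof -
  define g where "g s = \<phi> s * exp (c * s)" for s
  define g' where "g' s = (\<phi>' s + c * \<phi> s) * exp (c * s)" for s
  have "(g has_real_derivative g' s) (at s within {0..t})" if "s \<in> {0..t}" for s
  proof -
    have d: "(\<phi> has_real_derivative \<phi>' s) (at s within {0..t})"
      using assms(1,3) that by (meson DERIV_subset subsetD)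
    show ?thesis
      unfolding g_def g'_def by (rule derivative_eq_intros d refl)+ (simp add: algebra_simps)
  qed
  then obtain s where s: "s \<in> {0..t}" "g t - g 0 = g' s * (t - 0)"
    using mvt_very_simple[of 0 t g "\<lambda>s d. g' s * d"] \<open>0 \<le> t\<close>
    by (auto simp: has_field_derivative_def)
  have "\<phi>' s + c * \<phi> s \<le> 0"
    using assms(2)[of s] s assms(3) by auto
  then have "g' s \<le> 0" by (simp add: g'_def mult_nonpos_nonneg)
  then have "g t \<le> g 0" using s \<open>0 \<le> t\<close> by (smt (verit) mult_nonpos_nonneg)
  then show ?thesis by (simp add: g_def exp_minus field_simps)
qed

section \<open>The angles of one triangle\<close>

definition side_sq :: "real \<Rightarrow> real \<Rightarrow> real \<Rightarrow> real" where
  "side_sq p y z = y\<^sup>2 + z\<^sup>2 + 2 * y * z * p"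

text \<open>Sixteen times the squared area of the triangle with squared side lengths \<open>A\<close>, \<open>B\<close>, \<open>C\<close>, in the
form that extends as a polynomial to numbers that violate a triangle inequality.\<close>

definition heron :: "real \<Rightarrow> real \<Rightarrow> real \<Rightarrow> real" where
  "heron A B C = 4 * B * C - (B + C - A)\<^sup>2"

text \<open>The angle opposite to the side with squared length \<open>A\<close>. Clamping the cosine to \<open>[- 1, 1]\<close>
produces exactly the values \<open>\<pi>\<close> and \<open>0\<close> that the generalized angles take on degenerate
triangles, and it makes continuity evident.\<close>

definition angle_sq :: "real \<Rightarrow> real \<Rightarrow> real \<Rightarrow> real" where
  "angle_sq A B C = arccos (max (- 1) (min 1 ((B + C - A) / (2 * sqrt (B * C)))))"

text \<open>For circles of radii \<open>x\<close>, \<open>y\<close>, \<open>z\<close> with inversive distances \<open>p\<close>, \<open>q\<close>, \<open>s\<close> opposite to them, this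
divided by \<open>2 A sqrt (heron A B C)\<close> is the conductance of the edge with squared length \<open>A\<close>,
that is, the derivative of the angle at \<open>y\<close> with respect to \<open>ln z\<close>. It can be negative when an
inversive distance exceeds \<open>1\<close>.\<close>

definition edge_weight :: "real \<Rightarrow> real \<Rightarrow> real \<Rightarrow> real \<Rightarrow> real \<Rightarrow> real \<Rightarrow> real" where
  "edge_weight p q s x y z = 4 * y * z * (y * z * (1 - p\<^sup>2) + x * z * (s + p * q) + x * y * (q + p * s))"

lemma side_sq_pos: "0 < y \<Longrightarrow> 0 < z \<Longrightarrow> 0 \<le> p \<Longrightarrow> 0 < side_sq p y z"
  by (simp add: side_sq_def add_pos_nonneg)

lemma side_sq_commute: "side_sq p y z = side_sq p z y"
  by (simp add: side_sq_def mult_ac)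

lemma angle_sq_commute: "angle_sq A B C = angle_sq A C B"
  by (simp add: angle_sq_def mult_ac add_ac)

lemma heron_scale: "heron (m * A) (m * B) (m * C) = m\<^sup>2 * heron A B C"
  by (simp add: heron_def power2_eq_square algebra_simps)

lemma angle_sq_scale:
  assumes "0 < m"
  shows "angle_sq (m * A) (m * B) (m * C) = angle_sq A B C"
proof -
  have "sqrt (m * B * (m * C)) = m * sqrt (B * C)"
    using assms real_sqrt_mult[of "m\<^sup>2" "B * C"] by (simp add: power2_eq_square mult_ac)
  moreover have "m * B + m * C - m * A = m * (B + C - A)" by (simp add: algebra_simps)
  ultimately show ?thesis using assms by (simp add: angle_sq_def)
qed

lemma continuous_on_side_sq [continuous_intros]:
  "continuous_on S y \<Longrightarrow> continuous_on S z \<Longrightarrow> continuous_on S (\<lambda>t. side_sq p (y t) (z t))"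
  unfolding side_sq_def by (intro continuous_intros)

lemma continuous_on_angle_sq [continuous_intros]:
  assumes "continuous_on S A" "continuous_on S B" "continuous_on S C"
    and "\<And>t. t \<in> S \<Longrightarrow> 0 < B t" "\<And>t. t \<in> S \<Longrightarrow> 0 < C t"
  shows "continuous_on S (\<lambda>t. angle_sq (A t) (B t) (C t))"
  unfolding angle_sq_def using assms
  by (intro continuous_intros continuous_on_arccos) (fastforce dest: less_imp_neq)+

lemma cosine_lt_1_iff:
  assumes "0 < B" "0 < C"
  shows "\<bar>(B + C - A) / (2 * sqrt (B * C))\<bar> < 1 \<longleftrightarrow> 0 < heron A B C"
proof -
  have "\<bar>(B + C - A) / (2 * sqrt (B * C))\<bar> < 1 \<longleftrightarrow> \<bar>B + C - A\<bar> < \<bar>2 * sqrt (B * C)\<bar>"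
    using assms by (simp add: abs_mult)
  also have "\<dots> \<longleftrightarrow> (B + C - A)\<^sup>2 < (2 * sqrt (B * C))\<^sup>2"
    by (metis abs_le_square_iff linorder_not_less)
  also have "(2 * sqrt (B * C))\<^sup>2 = 4 * B * C"
    using assms by (simp add: power_mult_distrib)
  finally show ?thesis by (simp add: heron_def)
qed

lemma angle_sq_eq_arccos:
  assumes "0 < B" "0 < C" "0 < heron A B C"
  shows "angle_sq A B C = arccos ((B + C - A) / (2 * sqrt (B * C)))"
proof -
  have "\<bar>(B + C - A) / (2 * sqrt (B * C))\<bar> < 1"
    using cosine_lt_1_iff[of B C A] assms by blast
  then show ?thesis by (simp add: angle_sq_def abs_if split: if_splits)
qed

lemma angle_sq_degenerate:
  assumes "0 < B" "0 < C" "heron A B C \<le> 0"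
  shows "angle_sq A B C \<in> {0, pi}"
proof -
  have "\<not> \<bar>(B + C - A) / (2 * sqrt (B * C))\<bar> < 1"
    using cosine_lt_1_iff[of B C A] assms by simp
  then have "(B + C - A) / (2 * sqrt (B * C)) \<le> - 1 \<or> 1 \<le> (B + C - A) / (2 * sqrt (B * C))"
    by linarith
  then show ?thesis by (auto simp: angle_sq_def)
qed

lemma generalized_angle_eq_angle_sq:
  assumes "0 < a" "0 < b" "0 < c"
  shows "generalized_angle a b c = angle_sq (a\<^sup>2) (b\<^sup>2) (c\<^sup>2)"
proof -
  let ?m = "(b\<^sup>2 + c\<^sup>2 - a\<^sup>2) / (2 * b * c)"
  have sqrt: "sqrt (b\<^sup>2 * c\<^sup>2) = b * c" using assms by (simp add: real_sqrt_mult)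
  have eq: "angle_sq (a\<^sup>2) (b\<^sup>2) (c\<^sup>2) = arccos (max (- 1) (min 1 ?m))"
    unfolding angle_sq_def sqrt by (simp add: mult.assoc)
  have m1: "?m + 1 = (b + c - a) * (b + c + a) / (2 * b * c)"
    and m2: "1 - ?m = (a + b - c) * (a + c - b) / (2 * b * c)"
    using assms by (simp_all add: field_simps power2_eq_square)
  consider "a < b + c" "b < a + c" "c < a + b" | "b + c \<le> a" | "a + c \<le> b \<or> a + b \<le> c" by linarith
  then show ?thesis
  proof cases
    case 1
    then have "0 \<le> ?m + 1" "0 \<le> 1 - ?m" unfolding m1 m2 using assms by auto
    then have "max (- 1) (min 1 ?m) = ?m" by linarith
    then show ?thesis
      unfolding eq using 1 inner_angle_law_of_cosines[of a b c] by (simp add: generalized_angle_def)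
  next
    case 2
    then have "?m + 1 \<le> 0" unfolding m1 using assms
      by (auto intro!: divide_nonpos_pos mult_nonpos_nonneg)
    then have "max (- 1) (min 1 ?m) = - 1" by linarith
    then show ?thesis unfolding eq using 2 by (simp add: generalized_angle_def)
  next
    case 3
    then have "1 - ?m \<le> 0" unfolding m2 using assms
      by (auto intro!: divide_nonpos_pos intro: mult_nonpos_nonneg mult_nonneg_nonpos)
    then have "max (- 1) (min 1 ?m) = 1" by linarith
    then show ?thesis unfolding eq using 3 assms by (auto simp: generalized_angle_def)
  qed
qed

lemma heron_squares:
  "heron (a\<^sup>2) (b\<^sup>2) (c\<^sup>2) = (a + b + c) * (b + c - a) * (a + c - b) * (a + b - c)"
  unfolding heron_def by algebra

lemma heron_pos_iff:
  assumes "0 < a" "0 < b" "0 < c"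
  shows "0 < heron (a\<^sup>2) (b\<^sup>2) (c\<^sup>2) \<longleftrightarrow> a < b + c \<and> b < a + c \<and> c < a + b"
proof
  assume R: "a < b + c \<and> b < a + c \<and> c < a + b"
  then show "0 < heron (a\<^sup>2) (b\<^sup>2) (c\<^sup>2)" unfolding heron_squares using assms by simp
next
  assume L: "0 < heron (a\<^sup>2) (b\<^sup>2) (c\<^sup>2)"
  show "a < b + c \<and> b < a + c \<and> c < a + b"
  proof (rule ccontr)
    assume "\<not> ?thesis"
    then consider "b + c \<le> a" | "a + c \<le> b" | "a + b \<le> c" by linarith
    then have "(b + c - a) * ((a + c - b) * (a + b - c)) \<le> 0"
    proof cases
      case 1
      then show ?thesis using assms by (intro mult_nonpos_nonneg) auto
    next
      case 2
      then show ?thesis using assms by (intro mult_nonneg_nonpos mult_nonpos_nonneg) auto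
    next
      case 3
      then show ?thesis using assms by (intro mult_nonneg_nonpos) auto
    qed
    then have "(a + b + c) * ((b + c - a) * ((a + c - b) * (a + b - c))) \<le> 0"
      using assms by - (rule mult_nonneg_nonpos, auto)
    then show False using L by (simp only: heron_squares mult.assoc not_less[symmetric])
  qed
qed

text \<open>The cosine law determines the sines and cosines of the angles; the addition theorems give
\<open>cos (\<alpha> + \<beta>) = - cos \<gamma>\<close>, and \<open>sin (\<alpha> + \<beta>) = sin \<gamma> > 0\<close> excludes \<open>\<alpha> + \<beta> > \<pi>\<close>.\<close>

lemma angle_sum_pi_triangle:
  assumes pos: "0 < a" "0 < b" "0 < c" and tri: "a < b + c" "b < a + c" "c < a + b"
  shows "angle_sq (a\<^sup>2) (b\<^sup>2) (c\<^sup>2) + angle_sq (b\<^sup>2) (a\<^sup>2) (c\<^sup>2) + angle_sq (c\<^sup>2) (a\<^sup>2) (b\<^sup>2) = pi"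
proof -
  define H where "H = heron (a\<^sup>2) (b\<^sup>2) (c\<^sup>2)"
  have H: "0 < H" using heron_pos_iff[of a b c] assms by (simp add: H_def)
  have cs: "cos (angle_sq (a\<^sup>2) (b\<^sup>2) (c\<^sup>2)) = (b\<^sup>2 + c\<^sup>2 - a\<^sup>2) / (2 * b * c) \<and>
      sin (angle_sq (a\<^sup>2) (b\<^sup>2) (c\<^sup>2)) = sqrt (heron (a\<^sup>2) (b\<^sup>2) (c\<^sup>2)) / (2 * b * c) \<and>
      0 \<le> angle_sq (a\<^sup>2) (b\<^sup>2) (c\<^sup>2) \<and> angle_sq (a\<^sup>2) (b\<^sup>2) (c\<^sup>2) \<le> pi"
    if pos: "0 < a" "0 < b" "0 < c" and h: "0 < heron (a\<^sup>2) (b\<^sup>2) (c\<^sup>2)" for a b c :: real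
  proof -
    let ?m = "(b\<^sup>2 + c\<^sup>2 - a\<^sup>2) / (2 * b * c)"
    have sqrt: "2 * sqrt (b\<^sup>2 * c\<^sup>2) = 2 * b * c" using pos by (simp add: real_sqrt_mult)
    have m: "\<bar>?m\<bar> < 1"
      using cosine_lt_1_iff[of "b\<^sup>2" "c\<^sup>2" "a\<^sup>2"] pos h unfolding sqrt by simp
    have ang: "angle_sq (a\<^sup>2) (b\<^sup>2) (c\<^sup>2) = arccos ?m"
      using angle_sq_eq_arccos[of "b\<^sup>2" "c\<^sup>2" "a\<^sup>2"] pos h unfolding sqrt by simp
    have "1 - ?m\<^sup>2 = heron (a\<^sup>2) (b\<^sup>2) (c\<^sup>2) / (2 * b * c)\<^sup>2"
      using pos by (simp add: heron_def field_simps power2_eq_square)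
    moreover have "sqrt ((2 * b * c)\<^sup>2) = 2 * b * c"
      using pos by (intro real_sqrt_unique) auto
    ultimately have "sqrt (1 - ?m\<^sup>2) = sqrt (heron (a\<^sup>2) (b\<^sup>2) (c\<^sup>2)) / (2 * b * c)"
      by (simp only: real_sqrt_divide)
    then show ?thesis
      using m cos_arccos_abs[of ?m] sin_arccos_abs[of ?m] arccos_lbound[of ?m] arccos_ubound[of ?m]
      unfolding ang abs_less_iff by (intro conjI) linarith+
  qed
  define \<alpha> \<beta> \<gamma> where "\<alpha> = angle_sq (a\<^sup>2) (b\<^sup>2) (c\<^sup>2)" and "\<beta> = angle_sq (b\<^sup>2) (a\<^sup>2) (c\<^sup>2)"
    and "\<gamma> = angle_sq (c\<^sup>2) (a\<^sup>2) (b\<^sup>2)"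
  have hb: "heron (b\<^sup>2) (a\<^sup>2) (c\<^sup>2) = H" and hc: "heron (c\<^sup>2) (a\<^sup>2) (b\<^sup>2) = H"
    by (simp_all add: H_def heron_def power2_eq_square algebra_simps)
  define h where "h = sqrt H"
  note ca = cs[of a b c, folded \<alpha>_def H_def h_def, OF pos H]
  note cb = cs[of b a c, unfolded hb, folded \<beta>_def h_def, OF pos(2,1,3) H]
  note cc = cs[of c a b, unfolded hc, folded \<gamma>_def h_def, OF pos(3,1,2) H]
  have HH: "h * h = 4 * (b\<^sup>2) * (c\<^sup>2) - (b\<^sup>2 + c\<^sup>2 - a\<^sup>2)\<^sup>2"
    using H by (simp add: h_def H_def heron_def)
  have cos_eq: "cos \<alpha> = (b\<^sup>2 + c\<^sup>2 - a\<^sup>2) / (2 * b * c)" "cos \<beta> = (a\<^sup>2 + c\<^sup>2 - b\<^sup>2) / (2 * a * c)"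
      "cos \<gamma> = (a\<^sup>2 + b\<^sup>2 - c\<^sup>2) / (2 * a * b)"
    and sin_eq: "sin \<alpha> = h / (2 * b * c)" "sin \<beta> = h / (2 * a * c)" "sin \<gamma> = h / (2 * a * b)"
    using ca cb cc by blast+
  have range: "0 \<le> \<alpha>" "\<alpha> \<le> pi" "0 \<le> \<beta>" "\<beta> \<le> pi" "0 \<le> \<gamma>" "\<gamma> \<le> pi"
    using ca cb cc by blast+
  have "cos (\<alpha> + \<beta>) = ((b\<^sup>2 + c\<^sup>2 - a\<^sup>2) * (a\<^sup>2 + c\<^sup>2 - b\<^sup>2) - h * h) / (4 * a * b * c\<^sup>2)"
    unfolding cos_add cos_eq sin_eq using pos by (simp add: field_simps power2_eq_square)
  also have "\<dots> = - cos \<gamma>"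
    unfolding HH cos_eq using pos by (simp add: divide_simps) algebra
  finally have cos: "cos (\<alpha> + \<beta>) = - cos \<gamma>" .
  have sin: "sin (\<alpha> + \<beta>) = sin \<gamma>"
    unfolding sin_add cos_eq sin_eq using pos by (simp add: divide_simps) algebra
  have "0 < sin \<gamma>" unfolding sin_eq h_def using H pos by simp
  have "\<alpha> + \<beta> \<le> pi"
  proof (rule ccontr)
    assume "\<not> \<alpha> + \<beta> \<le> pi"
    then have "sin (\<alpha> + \<beta> - pi) \<ge> 0" using range by (intro sin_ge_zero) linarith+
    then show False using sin \<open>0 < sin \<gamma>\<close> by simp
  qed
  have cos': "cos (\<alpha> + \<beta>) = cos (pi - \<gamma>)" unfolding cos by simp
  have "\<alpha> + \<beta> = pi - \<gamma>"
    using range \<open>\<alpha> + \<beta> \<le> pi\<close> by (intro cos_inj_pi[OF _ _ _ _ cos']) linarith+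
  then show ?thesis by (simp add: \<alpha>_def \<beta>_def \<gamma>_def)
qed

lemma angle_sum_pi:
  assumes pos: "0 < A" "0 < B" "0 < C"
  shows "angle_sq A B C + angle_sq B A C + angle_sq C A B = pi"
proof -
  define a b c where "a = sqrt A" and "b = sqrt B" and "c = sqrt C"
  have abc: "0 < a" "0 < b" "0 < c" and sq: "A = a\<^sup>2" "B = b\<^sup>2" "C = c\<^sup>2"
    using pos by (auto simp: a_def b_def c_def)
  show ?thesis
  proof (cases "a < b + c \<and> b < a + c \<and> c < a + b")
    case True
    then show ?thesis unfolding sq using abc by (intro angle_sum_pi_triangle) auto
  next
    case False
    then show ?thesis
      unfolding sq using abc
      by (auto simp: generalized_angle_eq_angle_sq[symmetric] generalized_angle_def)
  qed
qed

section \<open>The angle derivative as a definite quadratic form\<close>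

text \<open>The rate at which \<open>\<alpha> \<theta>\<^sub>1 + \<beta> \<theta>\<^sub>2 + \<gamma> \<theta>\<^sub>3\<close> decreases when the logarithms of the radii move with
velocity \<open>(\<alpha>, \<beta>, \<gamma>)\<close> and the triangle is nondegenerate.\<close>

definition dissipation :: "real \<Rightarrow> real \<Rightarrow> real \<Rightarrow> real \<Rightarrow> real \<Rightarrow> real \<Rightarrow> real \<Rightarrow> real \<Rightarrow> real \<Rightarrow> real" where
  "dissipation p q s x y z \<alpha> \<beta> \<gamma> =
    (let A = side_sq p y z; B = side_sq q x z; C = side_sq s x y in
     (edge_weight p q s x y z / (2 * A) * (\<beta> - \<gamma>)\<^sup>2 +
      edge_weight q p s y x z / (2 * B) * (\<alpha> - \<gamma>)\<^sup>2 +
      edge_weight s q p z y x / (2 * C) * (\<alpha> - \<beta>)\<^sup>2) / sqrt (heron A B C))"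

text \<open>Up to positive factors the left-hand side is a principal 2 by 2 minor of the Jacobian of the
angles in the logarithms of the radii. That Jacobian is the product of the Jacobian of the
angles in the squared lengths, which has rank two, and the Jacobian of the squared lengths in
the logarithms of the radii. This explains why the minor factors: twice the factor next to the
Heron term is the determinant of the second matrix, which is visibly positive for positive radii
and nonnegative inversive distances.\<close>

lemma edge_weight_minor:
  assumes "A = side_sq p y z" "B = side_sq q x z" "C = side_sq s x y"
  shows "edge_weight p q s x y z * edge_weight q p s y x z * C
       + edge_weight q p s y x z * edge_weight s q p z y x * A
       + edge_weight s q p z y x * edge_weight p q s x y z * B
       = heron A B C * (4 * x * y * z *
          ((y + z * p) * (z + x * q) * (x + y * s) + (z + y * p) * (x + z * q) * (y + x * s)))"
  unfolding assms edge_weight_def heron_def side_sq_def by algebra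

text \<open>Negativity of the first weight forces \<open>y (p\<^sup>2 - 1) > x p q\<close>, that of the second \<open>x (q\<^sup>2 - 1) > y p q\<close>.
Multiplying the two gives \<open>(p\<^sup>2 - 1) (q\<^sup>2 - 1) > p\<^sup>2 q\<^sup>2\<close>, which is impossible when \<open>p\<close> and \<open>q\<close>
exceed \<open>1\<close>. The terms that are dropped for the two bounds are nonnegative because the
inversive distances are.\<close>

lemma edge_weights_not_both_negative:
  assumes "0 < x" "0 < y" "0 < z" "0 \<le> p" "0 \<le> q" "0 \<le> s"
  shows "\<not> (edge_weight p q s x y z < 0 \<and> edge_weight q p s y x z < 0)"
proof (rule notI, elim conjE)
  assume 1: "edge_weight p q s x y z < 0" and 2: "edge_weight q p s y x z < 0"
  have "y * z * (1 - p\<^sup>2) + x * z * (s + p * q) + x * y * (q + p * s) < 0"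
    using 1 assms by (auto simp: edge_weight_def mult_less_0_iff)
  moreover have "0 \<le> x * z * s" "0 \<le> x * y * (q + p * s)" using assms by auto
  ultimately have "z * (y * (1 - p\<^sup>2) + x * (p * q)) < 0" by (simp add: algebra_simps)
  then have a: "x * (p * q) < y * (p\<^sup>2 - 1)"
    using assms by (simp add: mult_less_0_iff) (simp add: algebra_simps)
  have "x * z * (1 - q\<^sup>2) + y * z * (s + q * p) + y * x * (p + q * s) < 0"
    using 2 assms by (auto simp: edge_weight_def mult_less_0_iff)
  moreover have "0 \<le> y * z * s" "0 \<le> y * x * (p + q * s)" using assms by auto
  ultimately have "z * (x * (1 - q\<^sup>2) + y * (p * q)) < 0" by (simp add: algebra_simps)
  then have b: "y * (p * q) < x * (q\<^sup>2 - 1)"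
    using assms by (simp add: mult_less_0_iff) (simp add: algebra_simps)
  have pq: "0 \<le> x * (p * q)" "0 \<le> y * (p * q)" using assms by auto
  have "(x * (p * q)) * (y * (p * q)) < (y * (p\<^sup>2 - 1)) * (x * (q\<^sup>2 - 1))"
    using mult_strict_mono'[OF a b pq] .
  then have "(x * y) * (p\<^sup>2 * q\<^sup>2) < (x * y) * ((p\<^sup>2 - 1) * (q\<^sup>2 - 1))"
    by (simp add: power2_eq_square mult_ac)
  then have lt: "p\<^sup>2 * q\<^sup>2 < (p\<^sup>2 - 1) * (q\<^sup>2 - 1)"
    using assms by simp
  have "0 < y * (p\<^sup>2 - 1)" "0 < x * (q\<^sup>2 - 1)" using a b pq by linarith+
  then have "1 < p\<^sup>2" "1 < q\<^sup>2" using assms by (auto simp: zero_less_mult_iff)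
  then show False using lt by (simp add: algebra_simps)
qed

text \<open>The form is definite modulo constants because its minor \<open>a b + b c + c a\<close> is positive. The minor
also shows that the pairwise sums of \<open>a\<close>, \<open>b\<close>, \<open>c\<close> have one common sign; if it were negative, two of
the three numbers would be negative.\<close>

lemma three_edge_form_pos:
  fixes a b c :: real
  assumes minor: "0 < a * b + b * c + c * a"
    and neg: "\<not> (a < 0 \<and> b < 0)" "\<not> (b < 0 \<and> c < 0)" "\<not> (a < 0 \<and> c < 0)"
    and ne: "\<not> (\<alpha> = \<beta> \<and> \<beta> = \<gamma>)"
  shows "0 < a * (\<beta> - \<gamma>)\<^sup>2 + b * (\<alpha> - \<gamma>)\<^sup>2 + c * (\<alpha> - \<beta>)\<^sup>2"
proof -
  define m where "m = a * b + b * c + c * a"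
  have m: "0 < m" using minor by (simp add: m_def)
  have 1: "0 < (a + c) * (b + c)" and 2: "0 < (a + c) * (a + b)"
    using add_pos_nonneg[OF m zero_le_power2[of c]] add_pos_nonneg[OF m zero_le_power2[of a]]
    by (simp_all add: m_def power2_eq_square algebra_simps)
  have ac: "0 < a + c"
    using 1 2 neg by (smt (verit) zero_less_mult_iff)
  define X where "X = \<beta> - \<gamma>"
  define Y where "Y = \<alpha> - \<beta>"
  let ?Q = "a * (\<beta> - \<gamma>)\<^sup>2 + b * (\<alpha> - \<gamma>)\<^sup>2 + c * (\<alpha> - \<beta>)\<^sup>2"
  have "(a + b) * ?Q = ((a + b) * X + b * Y)\<^sup>2 + m * Y\<^sup>2"
    by (simp add: X_def Y_def m_def) algebra
  moreover have "0 < ((a + b) * X + b * Y)\<^sup>2 + m * Y\<^sup>2"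
  proof (cases "Y = 0")
    case True
    then have "X \<noteq> 0" using ne by (auto simp: X_def Y_def)
    moreover have "a + b \<noteq> 0" using 2 by auto
    ultimately show ?thesis using True by simp
  next
    case False
    then show ?thesis using m by (simp add: add_nonneg_pos)
  qed
  moreover have "0 < a + b" using 2 ac by (simp add: zero_less_mult_iff)
  ultimately show ?thesis by (smt (verit) zero_less_mult_iff)
qed

lemma dissipation_pos:
  assumes pos: "0 < x" "0 < y" "0 < z" "0 \<le> p" "0 \<le> q" "0 \<le> s"
    and heron: "0 < heron (side_sq p y z) (side_sq q x z) (side_sq s x y)"
    and ne: "\<not> (\<alpha> = \<beta> \<and> \<beta> = \<gamma>)"
  shows "0 < dissipation p q s x y z \<alpha> \<beta> \<gamma>"
proof -
  define A B C where "A = side_sq p y z" and "B = side_sq q x z" and "C = side_sq s x y"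
  define E F G where "E = edge_weight p q s x y z" and "F = edge_weight q p s y x z"
    and "G = edge_weight s q p z y x"
  have ABC: "0 < A" "0 < B" "0 < C"
    using pos by (auto simp: A_def B_def C_def intro: side_sq_pos)
  have swap: "edge_weight p s q x z y = E" "edge_weight q s p y z x = F" "edge_weight s p q z x y = G"
    by (simp_all add: E_def F_def G_def edge_weight_def algebra_simps)
  have "E * F * C + F * G * A + G * E * B
      = heron A B C * (4 * x * y * z *
          ((y + z * p) * (z + x * q) * (x + y * s) + (z + y * p) * (x + z * q) * (y + x * s)))"
    unfolding E_def F_def G_def by (rule edge_weight_minor) (simp_all add: A_def B_def C_def)
  also have "0 < \<dots>"
    using pos heron by (intro mult_pos_pos add_pos_pos add_pos_nonneg mult_nonneg_nonneg) (auto simp: A_def B_def C_def)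
  finally have minor: "0 < E * F * C + F * G * A + G * E * B" .
  have "E / (2*A) * (F / (2*B)) + F / (2*B) * (G / (2*C)) + G / (2*C) * (E / (2*A))
      = (E * F * C + F * G * A + G * E * B) / (4 * A * B * C)"
    using ABC by (simp add: field_simps)
  then have "0 < E / (2*A) * (F / (2*B)) + F / (2*B) * (G / (2*C)) + G / (2*C) * (E / (2*A))"
    using minor ABC by simp
  moreover have "\<not> (E < 0 \<and> F < 0)"
    using edge_weights_not_both_negative[of x y z p q s] pos by (simp add: E_def F_def)
  moreover have "\<not> (F < 0 \<and> G < 0)"
    using edge_weights_not_both_negative[of y z x q s p] pos swap by (simp add: F_def G_def)
  moreover have "\<not> (E < 0 \<and> G < 0)"
    using edge_weights_not_both_negative[of x z y p s q] pos swap by (simp add: E_def G_def)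
  ultimately have "0 < E / (2*A) * (\<beta> - \<gamma>)\<^sup>2 + F / (2*B) * (\<alpha> - \<gamma>)\<^sup>2 + G / (2*C) * (\<alpha> - \<beta>)\<^sup>2"
    using ABC ne by (intro three_edge_form_pos) (auto simp: divide_less_0_iff)
  then show ?thesis
    using heron by (simp add: dissipation_def Let_def A_def B_def C_def E_def F_def G_def)
qed

lemma dissipation_nonneg:
  assumes "0 < x" "0 < y" "0 < z" "0 \<le> p" "0 \<le> q" "0 \<le> s"
    and "0 < heron (side_sq p y z) (side_sq q x z) (side_sq s x y)"
  shows "0 \<le> dissipation p q s x y z \<alpha> \<beta> \<gamma>"
proof (cases "\<alpha> = \<beta> \<and> \<beta> = \<gamma>")
  case True then show ?thesis by (simp add: dissipation_def)
next
  case False then show ?thesis using dissipation_pos assms by (meson less_imp_le)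
qed

text \<open>The derivative of the cosine law, written in squared lengths: the denominator
\<open>sqrt (heron A B C)\<close> comes from the sine of the angle.\<close>

lemma angle_sq_has_derivative:
  assumes d: "(A has_real_derivative A') (at t)" "(B has_real_derivative B') (at t)"
      "(C has_real_derivative C') (at t)"
    and pos: "0 < B t" "0 < C t" and heron: "0 < heron (A t) (B t) (C t)"
  shows "((\<lambda>t. angle_sq (A t) (B t) (C t)) has_real_derivative
     (A' - B' * (A t + B t - C t) / (2 * B t) - C' * (A t + C t - B t) / (2 * C t))
       / sqrt (heron (A t) (B t) (C t))) (at t)"
proof -
  define m where "m t = (B t + C t - A t) / (2 * sqrt (B t * C t))" for t
  define R where "R = sqrt (B t * C t)"
  have R: "0 < R" "R\<^sup>2 = B t * C t" using pos by (auto simp: R_def)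
  have cont: "isCont A t" "isCont B t" "isCont C t"
    using d by (auto intro: DERIV_isCont)
  have near: "eventually (\<lambda>s. 0 < f s) (nhds t)" if "isCont f t" "0 < f t" for f :: "real \<Rightarrow> real"
    using that by (auto simp: continuous_within tendsto_at_iff_tendsto_nhds intro: order_tendstoD)
  have "eventually (\<lambda>s. 0 < B s) (nhds t)" "eventually (\<lambda>s. 0 < C s) (nhds t)"
    using cont pos by (auto intro: near)
  moreover have "eventually (\<lambda>s. 0 < heron (A s) (B s) (C s)) (nhds t)"
  proof -
    have "isCont (\<lambda>s. heron (A s) (B s) (C s)) t"
      unfolding heron_def using cont by (intro continuous_intros)
    then show ?thesis
      using heron by (rule near)
  qed
  ultimately have ev: "eventually (\<lambda>s. angle_sq (A s) (B s) (C s) = arccos (m s)) (nhds t)"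
    by eventually_elim (simp add: angle_sq_eq_arccos m_def)
  have m1: "\<bar>m t\<bar> < 1"
    using cosine_lt_1_iff[of "B t" "C t" "A t"] pos heron by (simp add: m_def)
  define D where "D = (B' + C' - A') / (2 * R) - (B t + C t - A t) * (B' * C t + B t * C') / (4 * R ^ 3)"
  have "(m has_real_derivative D) (at t)"
  proof -
    have "((\<lambda>s. 2 * sqrt (B s * C s)) has_real_derivative
        2 * (inverse (sqrt (B t * C t)) / 2 * (B' * C t + C' * B t))) (at t)"
      using pos by (intro DERIV_cmult DERIV_chain2[OF DERIV_real_sqrt] DERIV_mult d) auto
    then have "(m has_real_derivative
        ((B' + C' - A') * (2 * sqrt (B t * C t))
          - (B t + C t - A t) * (2 * (inverse (sqrt (B t * C t)) / 2 * (B' * C t + C' * B t))))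
         / (2 * sqrt (B t * C t) * (2 * sqrt (B t * C t)))) (at t)"
      unfolding m_def using pos by (intro DERIV_divide DERIV_diff DERIV_add d) auto
    moreover have "((B' + C' - A') * (2 * R)
          - (B t + C t - A t) * (2 * (inverse R / 2 * (B' * C t + C' * B t)))) / (2 * R * (2 * R)) = D"
      using R(1) by (simp add: D_def field_simps power2_eq_square power3_eq_cube)
    ultimately show ?thesis by (simp add: R_def)
  qed
  then have der: "((\<lambda>s. arccos (m s)) has_real_derivative inverse (- sqrt (1 - (m t)\<^sup>2)) * D) (at t)"
    using m1 by (intro DERIV_chain2[OF DERIV_arccos]) auto
  have "1 - (m t)\<^sup>2 = heron (A t) (B t) (C t) / (2 * R)\<^sup>2"
    using R pos by (simp add: m_def heron_def power_divide power_mult_distrib field_simps flip: R_def)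
  moreover have "sqrt ((2 * R)\<^sup>2) = 2 * R"
    using R(1) by (intro real_sqrt_unique) auto
  ultimately have sq: "sqrt (1 - (m t)\<^sup>2) = sqrt (heron (A t) (B t) (C t)) / (2 * R)"
    by (simp only: real_sqrt_divide)
  have R3: "R ^ 3 = R * (B t * C t)" using R by (simp add: power3_eq_cube power2_eq_square)
  have D: "- (2 * R) * D = A' - B' * (A t + B t - C t) / (2 * B t) - C' * (A t + C t - B t) / (2 * C t)"
    using R(1) pos unfolding D_def R3 by (simp add: field_simps)
  have "inverse (- sqrt (1 - (m t)\<^sup>2)) * D = (- (2 * R) * D) / sqrt (heron (A t) (B t) (C t))"
    unfolding sq using R heron by (simp add: field_simps)
  with der D have "((\<lambda>s. arccos (m s)) has_real_derivative
     (A' - B' * (A t + B t - C t) / (2 * B t) - C' * (A t + C t - B t) / (2 * C t))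
       / sqrt (heron (A t) (B t) (C t))) (at t)" by simp
  then show ?thesis
    using DERIV_cong_ev[OF refl ev refl] by simp
qed

text \<open>In this form the weight is polynomial in the squared lengths and the squared radii alone, which
turns the next identity into one that is rational in these six quantities and the velocities.\<close>

lemma edge_weight_side_sq:
  assumes "A = side_sq p y z" "B = side_sq q x z" "C = side_sq s x y"
  shows "edge_weight p q s x y z = A * (B + C - A + y\<^sup>2 + z\<^sup>2 - 2 * x\<^sup>2) - (B - C) * (z\<^sup>2 - y\<^sup>2) "
  unfolding assms edge_weight_def side_sq_def by algebra

text \<open>Scaling all radii keeps the angles, and their sum is constant, so the rows and columns of the
Jacobian add up to zero. It is moreover symmetric; hence its quadratic form is a combination of
the squared differences of \<open>\<alpha>\<close>, \<open>\<beta>\<close>, \<open>\<gamma>\<close>. The weights turn out to be the edge weights.\<close>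

lemma weighted_angle_derivative:
  fixes x y z \<alpha> \<beta> \<gamma> p q s :: real
  defines "A \<equiv> side_sq p y z" and "B \<equiv> side_sq q x z" and "C \<equiv> side_sq s x y"
  assumes pos: "0 < A" "0 < B" "0 < C"
    and A': "A' = (A + y\<^sup>2 - z\<^sup>2) * \<beta> + (A + z\<^sup>2 - y\<^sup>2) * \<gamma>"
    and B': "B' = (B + x\<^sup>2 - z\<^sup>2) * \<alpha> + (B + z\<^sup>2 - x\<^sup>2) * \<gamma>"
    and C': "C' = (C + x\<^sup>2 - y\<^sup>2) * \<alpha> + (C + y\<^sup>2 - x\<^sup>2) * \<beta>"
  shows "\<alpha> * ((A' - B' * (A + B - C) / (2 * B) - C' * (A + C - B) / (2 * C)) / sqrt (heron A B C))
    + \<beta> * ((B' - A' * (B + A - C) / (2 * A) - C' * (B + C - A) / (2 * C)) / sqrt (heron A B C))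
    + \<gamma> * ((C' - A' * (C + A - B) / (2 * A) - B' * (C + B - A) / (2 * B)) / sqrt (heron A B C))
    = - dissipation p q s x y z \<alpha> \<beta> \<gamma>"
proof -
  have E: "edge_weight p q s x y z = A * (B + C - A + y\<^sup>2 + z\<^sup>2 - 2 * x\<^sup>2) - (B - C) * (z\<^sup>2 - y\<^sup>2)"
    by (rule edge_weight_side_sq) (simp_all add: A_def B_def C_def)
  have F: "edge_weight q p s y x z = B * (A + C - B + x\<^sup>2 + z\<^sup>2 - 2 * y\<^sup>2) - (A - C) * (z\<^sup>2 - x\<^sup>2)"
    by (rule edge_weight_side_sq) (simp_all add: A_def B_def C_def side_sq_commute)
  have G: "edge_weight s q p z y x = C * (B + A - C + y\<^sup>2 + x\<^sup>2 - 2 * z\<^sup>2) - (B - A) * (x\<^sup>2 - y\<^sup>2)"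
    by (rule edge_weight_side_sq) (simp_all add: A_def B_def C_def side_sq_commute)
  have "\<alpha> * (A' - B' * (A + B - C) / (2 * B) - C' * (A + C - B) / (2 * C))
    + \<beta> * (B' - A' * (B + A - C) / (2 * A) - C' * (B + C - A) / (2 * C))
    + \<gamma> * (C' - A' * (C + A - B) / (2 * A) - B' * (C + B - A) / (2 * B))
    = - (edge_weight p q s x y z / (2 * A) * (\<beta> - \<gamma>)\<^sup>2 +
      edge_weight q p s y x z / (2 * B) * (\<alpha> - \<gamma>)\<^sup>2 +
      edge_weight s q p z y x / (2 * C) * (\<alpha> - \<beta>)\<^sup>2)"
    unfolding E F G A' B' C' using pos by (simp add: divide_simps) algebra
  then show ?thesis
    unfolding dissipation_def Let_def A_def[symmetric] B_def[symmetric] C_def[symmetric]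
      times_divide_eq_right add_divide_distrib[symmetric] by (simp only: minus_divide_left)
qed

definition weighted_angles :: "real \<Rightarrow> real \<Rightarrow> real \<Rightarrow> real \<Rightarrow> real \<Rightarrow> real \<Rightarrow> real \<Rightarrow> real \<Rightarrow> real \<Rightarrow> real" where
  "weighted_angles p q s x y z \<alpha> \<beta> \<gamma> =
    (let A = side_sq p y z; B = side_sq q x z; C = side_sq s x y in
     \<alpha> * angle_sq A B C + \<beta> * angle_sq B A C + \<gamma> * angle_sq C A B)"

lemma side_sq_exp_has_derivative:
  fixes p b \<beta> c \<gamma> t :: real
  defines "A \<equiv> \<lambda>t. side_sq p (exp (b + t * \<beta>)) (exp (c + t * \<gamma>))"
  shows "(A has_real_derivative
     (A t + (exp (b + t * \<beta>))\<^sup>2 - (exp (c + t * \<gamma>))\<^sup>2) * \<beta> +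
     (A t + (exp (c + t * \<gamma>))\<^sup>2 - (exp (b + t * \<beta>))\<^sup>2) * \<gamma>) (at t)"
  unfolding A_def side_sq_def
  by (rule derivative_eq_intros refl)+ (simp add: power2_eq_square algebra_simps)

lemma weighted_angles_has_derivative:
  fixes a b c \<alpha> \<beta> \<gamma> p q s t :: real
  defines "\<And>t. x t \<equiv> exp (a + t * \<alpha>)" and "\<And>t. y t \<equiv> exp (b + t * \<beta>)" and "\<And>t. z t \<equiv> exp (c + t * \<gamma>)"
  assumes "0 \<le> p" "0 \<le> q" "0 \<le> s"
    and heron: "0 < heron (side_sq p (y t) (z t)) (side_sq q (x t) (z t)) (side_sq s (x t) (y t))"
  shows "((\<lambda>t. weighted_angles p q s (x t) (y t) (z t) \<alpha> \<beta> \<gamma>) has_real_derivative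
      - dissipation p q s (x t) (y t) (z t) \<alpha> \<beta> \<gamma>) (at t)"
proof -
  have pos: "0 < side_sq p (y t) (z t)" "0 < side_sq q (x t) (z t)" "0 < side_sq s (x t) (y t)"
    using assms by (auto simp: x_def y_def z_def intro: side_sq_pos)
  note A' = side_sq_exp_has_derivative[of p b \<beta> c \<gamma> t, folded y_def z_def]
  note B' = side_sq_exp_has_derivative[of q a \<alpha> c \<gamma> t, folded x_def z_def]
  note C' = side_sq_exp_has_derivative[of s a \<alpha> b \<beta> t, folded x_def y_def]
  let ?A = "side_sq p (y t) (z t)" and ?B = "side_sq q (x t) (z t)" and ?C = "side_sq s (x t) (y t)"
  have hB: "heron ?B ?A ?C = heron ?A ?B ?C" and hC: "heron ?C ?A ?B = heron ?A ?B ?C"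
    by (simp_all add: heron_def power2_eq_square algebra_simps)
  note dA = angle_sq_has_derivative[OF A' B' C' pos(2,3) heron]
  note dB = angle_sq_has_derivative[OF B' A' C' pos(1,3) heron[folded hB], unfolded hB]
  note dC = angle_sq_has_derivative[OF C' A' B' pos(1,2) heron[folded hC], unfolded hC]
  show ?thesis
    unfolding weighted_angles_def Let_def
      weighted_angle_derivative[symmetric, OF pos refl refl refl]
    by (rule DERIV_add[OF DERIV_add[OF DERIV_cmult[OF dA] DERIV_cmult[OF dB]] DERIV_cmult[OF dC]])
qed

lemma continuous_on_dissipation:
  fixes x y z \<alpha> \<beta> \<gamma> :: "'a::topological_space \<Rightarrow> real"
  assumes cont: "continuous_on S x" "continuous_on S y" "continuous_on S z"
      "continuous_on S \<alpha>" "continuous_on S \<beta>" "continuous_on S \<gamma>"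
    and pos: "\<And>t. t \<in> S \<Longrightarrow> 0 < x t" "\<And>t. t \<in> S \<Longrightarrow> 0 < y t" "\<And>t. t \<in> S \<Longrightarrow> 0 < z t"
    and I: "0 \<le> p" "0 \<le> q" "0 \<le> s"
    and heron: "\<And>t. t \<in> S \<Longrightarrow>
        0 < heron (side_sq p (y t) (z t)) (side_sq q (x t) (z t)) (side_sq s (x t) (y t))"
  shows "continuous_on S (\<lambda>t. dissipation p q s (x t) (y t) (z t) (\<alpha> t) (\<beta> t) (\<gamma> t))"
proof -
  have side: "side_sq p (y t) (z t) \<noteq> 0" "side_sq q (x t) (z t) \<noteq> 0" "side_sq s (x t) (y t) \<noteq> 0"
    if "t \<in> S" for t
    using side_sq_pos pos I that by (metis less_irrefl)+
  have h: "heron (side_sq p (y t) (z t)) (side_sq q (x t) (z t)) (side_sq s (x t) (y t)) \<noteq> 0"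
    if "t \<in> S" for t using heron[OF that] by simp
  have contH: "continuous_on S (\<lambda>t. heron (side_sq p (y t) (z t)) (side_sq q (x t) (z t)) (side_sq s (x t) (y t)))"
    unfolding heron_def by (intro continuous_intros cont)
  show ?thesis
    unfolding dissipation_def Let_def edge_weight_def
    by (intro continuous_intros cont contH) (use side h in auto)
qed

section \<open>Monotonicity across degenerate triangles\<close>

text \<open>If \<open>f\<close> ended higher than it began, it would have to climb through an interval of values that
avoids the finite set \<open>Y\<close>. Between the last time at the bottom and the first later time at the
top of this interval the derivative is nonpositive, a contradiction. The set of times with
\<open>f t \<in> Y\<close> can be an arbitrary closed set.\<close>

lemma nonincreasing_off_finite_values:
  fixes f :: "real \<Rightarrow> real"
  assumes cont: "continuous_on {a..b} f" and "a \<le> b" and "finite Y"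
    and der: "\<And>t. t \<in> {a..b} \<Longrightarrow> f t \<notin> Y \<Longrightarrow> \<exists>d\<le>0. (f has_real_derivative d) (at t)"
  shows "f b \<le> f a"
proof (rule ccontr)
  assume "\<not> f b \<le> f a"
  then have less: "f a < f b" by simp
  \<comment> \<open>A closed interval of values between \<open>f a\<close> and \<open>f b\<close> that misses \<open>Y\<close>.\<close>
  have "open ({f a<..<f b} - Y)"
    using \<open>finite Y\<close> by (intro open_Diff finite_imp_closed) auto
  have "infinite ({f a<..<f b} - Y)"
    using \<open>finite Y\<close> less by (intro Diff_infinite_finite) (auto simp: infinite_Ioo)
  then obtain y where "y \<in> {f a<..<f b} - Y"
    by (metis finite.emptyI equals0I)
  with \<open>open ({f a<..<f b} - Y)\<close> obtain e where e: "0 < e" "cball y e \<subseteq> {f a<..<f b} - Y"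
    by (meson open_contains_cball)
  define y1 y2 where "y1 = y - e" and "y2 = y + e"
  have free: "{y1..y2} \<inter> Y = {}" and "y1 < y2" and y1: "f a < y1" and y2: "y2 < f b"
    using e by (auto simp: y1_def y2_def cball_eq_atLeastAtMost subset_iff)
  have "compact {t \<in> {a..b}. f t \<le> y1}"
  proof -
    have "{t \<in> {a..b}. f t \<le> y1} = {a..b} \<inter> f -` {..y1}" by auto
    then show ?thesis
      using continuous_closed_preimage[OF cont closed_atLeastAtMost closed_atMost[of y1]]
      by (simp only: compact_eq_bounded_closed) (auto intro: bounded_Int)
  qed
  moreover have "a \<in> {t \<in> {a..b}. f t \<le> y1}" using y1 \<open>a \<le> b\<close> by auto
  ultimately obtain s1 where s1: "s1 \<in> {a..b}" "f s1 \<le> y1"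
      "\<And>t. t \<in> {a..b} \<Longrightarrow> f t \<le> y1 \<Longrightarrow> t \<le> s1"
    using compact_attains_sup[of "{t \<in> {a..b}. f t \<le> y1}"] by blast
  have cont1: "continuous_on {s1..b} f"
    using cont by (rule continuous_on_subset) (use s1 in auto)
  have "compact {t \<in> {s1..b}. y2 \<le> f t}"
  proof -
    have "{t \<in> {s1..b}. y2 \<le> f t} = {s1..b} \<inter> f -` {y2..}" by auto
    then show ?thesis
      using continuous_closed_preimage[OF cont1 closed_atLeastAtMost closed_atLeast[of y2]]
      by (simp only: compact_eq_bounded_closed) (auto intro: bounded_Int)
  qed
  moreover have "b \<in> {t \<in> {s1..b}. y2 \<le> f t}" using y2 s1 by auto
  ultimately obtain s2 where s2: "s2 \<in> {s1..b}" "y2 \<le> f s2"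
      "\<And>t. t \<in> {s1..b} \<Longrightarrow> y2 \<le> f t \<Longrightarrow> s2 \<le> t"
    using compact_attains_inf[of "{t \<in> {s1..b}. y2 \<le> f t}"] by blast
  have "f s2 \<le> f s1"
  proof (rule DERIV_nonpos_imp_decreasing_open[of s1 s2 f])
    fix t assume t: "s1 < t" "t < s2"
    have ab: "t \<in> {a..b}" "t \<in> {s1..b}" using t s1(1) s2(1) by auto
    have "\<not> f t \<le> y1" "\<not> y2 \<le> f t" using t s1(3)[of t] s2(3)[of t] ab by auto
    then have "f t \<in> {y1..y2}" by simp
    then have "f t \<notin> Y" using free by blast
    then show "\<exists>d. (f has_real_derivative d) (at t) \<and> d \<le> 0"
      using der[OF ab(1)] by blast
  next
    show "continuous_on {s1..s2} f"
      using cont1 by (rule continuous_on_subset) (use s2 in auto)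
  qed (use s2 in auto)
  then show False using s1 s2 \<open>y1 < y2\<close> by linarith
qed

text \<open>The segment between two positions may cross degenerate triangles, where the angles need not be
differentiable. There each angle is \<open>0\<close> or \<open>\<pi>\<close>, and the weighted sum has at most eight values.\<close>

lemma weighted_angles_decreasing:
  fixes a b c \<alpha> \<beta> \<gamma> p q s :: real
  assumes I: "0 \<le> p" "0 \<le> q" "0 \<le> s"
  shows "weighted_angles p q s (exp (a + \<alpha>)) (exp (b + \<beta>)) (exp (c + \<gamma>)) \<alpha> \<beta> \<gamma>
    \<le> weighted_angles p q s (exp a) (exp b) (exp c) \<alpha> \<beta> \<gamma>"
proof -
  define x y z where "x t = exp (a + t * \<alpha>)" and "y t = exp (b + t * \<beta>)" and "z t = exp (c + t * \<gamma>)" for t :: real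
  define f where "f t = weighted_angles p q s (x t) (y t) (z t) \<alpha> \<beta> \<gamma>" for t
  define Y where "Y = (\<lambda>(i, j, k). \<alpha> * i + \<beta> * j + \<gamma> * k) ` ({0, pi} \<times> {0, pi} \<times> {0, pi})"
  have pos: "0 < side_sq p (y t) (z t)" "0 < side_sq q (x t) (z t)" "0 < side_sq s (x t) (y t)" for t
    using assms by (auto simp: x_def y_def z_def intro: side_sq_pos)
  have "f 1 \<le> f 0"
  proof (rule nonincreasing_off_finite_values[of 0 1 f Y])
    show "continuous_on {0..1} f"
      unfolding f_def weighted_angles_def Let_def
      using pos by (intro continuous_intros) (auto simp: x_def y_def z_def intro!: continuous_intros)
    fix t assume "f t \<notin> Y"
    have "0 < heron (side_sq p (y t) (z t)) (side_sq q (x t) (z t)) (side_sq s (x t) (y t))"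
    proof (rule ccontr)
      let ?A = "side_sq p (y t) (z t)" and ?B = "side_sq q (x t) (z t)" and ?C = "side_sq s (x t) (y t)"
      assume "\<not> 0 < heron ?A ?B ?C"
      then have "heron ?A ?B ?C \<le> 0" "heron ?B ?A ?C \<le> 0" "heron ?C ?A ?B \<le> 0"
        by (auto simp: heron_def power2_eq_square algebra_simps)
      then have "angle_sq ?A ?B ?C \<in> {0, pi}" "angle_sq ?B ?A ?C \<in> {0, pi}" "angle_sq ?C ?A ?B \<in> {0, pi}"
        using pos[of t] by (simp_all only: angle_sq_degenerate)
      then have "(angle_sq ?A ?B ?C, angle_sq ?B ?A ?C, angle_sq ?C ?A ?B) \<in> {0, pi} \<times> {0, pi} \<times> {0, pi}"
        by blast
      then have "f t \<in> Y"
        unfolding f_def weighted_angles_def Let_def Y_def by (rule rev_image_eqI) simp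
      then show False using \<open>f t \<notin> Y\<close> by simp
    qed
    then show "\<exists>d\<le>0. (f has_real_derivative d) (at t)"
      using weighted_angles_has_derivative[of p q s b t \<beta> c \<gamma> a \<alpha>] 
        dissipation_nonneg[of "x t" "y t" "z t" p q s \<alpha> \<beta> \<gamma>] I
      unfolding f_def x_def y_def z_def by (intro exI conjI) auto
  qed (auto simp: Y_def)
  then show ?thesis by (simp add: f_def x_def y_def z_def)
qed

section \<open>Curvature in logarithmic coordinates\<close>

text \<open>Connectedness of the surface enters as a discrete statement: a function on the vertices that is
constant on every face is constant.\<close>

locale inversive_distance_surface =
  fixes F :: "'v::finite set set" and I :: "'v set \<Rightarrow> real"
  assumes card_face: "f \<in> F \<Longrightarrow> card f = 3"
    and I_nonneg: "e \<in> edges F \<Longrightarrow> 0 \<le> I e"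
    and locally_constant: "(\<And>i j k. {i, j, k} \<in> F \<Longrightarrow> \<phi> i = (\<phi> j :: real)) \<Longrightarrow> \<phi> i = \<phi> j"
begin

text \<open>A face \<open>{i, j, k}\<close> appears here with its six orderings. Sums over this set are invariant under
rotating the triple, which avoids choosing an ordering of each face.\<close>

definition corners :: "('v \<times> 'v \<times> 'v) set" where
  "corners = {(i, j, k). {i, j, k} \<in> F}"

definition length_sq :: "real^'v \<Rightarrow> 'v \<Rightarrow> 'v \<Rightarrow> real" where
  "length_sq u i j = side_sq (I {i, j}) (exp (u$i)) (exp (u$j))"

definition log_curvature :: "real^'v \<Rightarrow> real^'v" where
  "log_curvature u = extended_curvature F I (\<chi> i. exp (u$i))"

definition log_Omega :: "(real^'v) set" where
  "log_Omega = {u. (\<chi> i. exp (u$i)) \<in> Omega F I}"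

definition corner_angle :: "real^'v \<Rightarrow> 'v \<Rightarrow> 'v \<Rightarrow> 'v \<Rightarrow> real" where
  "corner_angle u i j k = angle_sq (length_sq u j k) (length_sq u i k) (length_sq u i j)"

definition face_angles :: "real^'v \<Rightarrow> real^'v \<Rightarrow> 'v \<times> 'v \<times> 'v \<Rightarrow> real" where
  "face_angles w u = (\<lambda>(i, j, k). weighted_angles (I {j, k}) (I {i, k}) (I {i, j})
     (exp (u$i)) (exp (u$j)) (exp (u$k)) (w$i) (w$j) (w$k))"

definition face_dissipation :: "real^'v \<Rightarrow> real^'v \<Rightarrow> 'v \<times> 'v \<times> 'v \<Rightarrow> real" where
  "face_dissipation w u = (\<lambda>(i, j, k). dissipation (I {j, k}) (I {i, k}) (I {i, j})
     (exp (u$i)) (exp (u$j)) (exp (u$k)) (w$i) (w$j) (w$k))"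

lemma finite_corners: "finite corners"
  by simp

lemma I_corner:
  assumes "{i, j, k} \<in> F"
  shows "0 \<le> I {j, k}" "0 \<le> I {i, k}" "0 \<le> I {i, j}"
proof -
  have "i \<noteq> j" "j \<noteq> k" "i \<noteq> k"
    using card_face[OF assms] by (auto simp: card_insert_if split: if_splits)
  then have "{j, k} \<in> edges F" "{i, k} \<in> edges F" "{i, j} \<in> edges F"
    using assms by (auto simp: edges_def intro!: bexI[OF _ assms])
  then show "0 \<le> I {j, k}" "0 \<le> I {i, k}" "0 \<le> I {i, j}" by (auto intro: I_nonneg)
qed

lemma length_sq_commute: "length_sq u i j = length_sq u j i"
  by (simp add: length_sq_def insert_commute side_sq_commute)

lemma length_sq_pos:
  assumes "{i, j, k} \<in> F"
  shows "0 < length_sq u j k" "0 < length_sq u i k" "0 < length_sq u i j"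
  using I_corner[OF assms] by (simp_all add: length_sq_def side_sq_pos)

lemma edge_length_exp: "edge_length I (\<chi> i. exp (u$i)) i j = sqrt (length_sq u i j)"
  by (simp add: edge_length_def length_sq_def side_sq_def)

lemma log_Omega_iff:
  "u \<in> log_Omega \<longleftrightarrow> (\<forall>i j k. {i, j, k} \<in> F \<longrightarrow>
     0 < heron (length_sq u j k) (length_sq u i k) (length_sq u i j))"
proof -
  have iff: "0 < heron (length_sq u j k) (length_sq u i k) (length_sq u i j) \<longleftrightarrow>
      sqrt (length_sq u j k) < sqrt (length_sq u i k) + sqrt (length_sq u i j) \<and>
      sqrt (length_sq u i k) < sqrt (length_sq u j k) + sqrt (length_sq u i j) \<and>
      sqrt (length_sq u i j) < sqrt (length_sq u j k) + sqrt (length_sq u i k)"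
    if "{i, j, k} \<in> F" for i j k
    using heron_pos_iff[of "sqrt (length_sq u j k)" "sqrt (length_sq u i k)" "sqrt (length_sq u i j)"]
      length_sq_pos[OF that, of u] by simp
  have L: "u \<in> log_Omega \<longleftrightarrow> (\<forall>i j k. {i, j, k} \<in> F \<longrightarrow>
     sqrt (length_sq u j k) < sqrt (length_sq u i j) + sqrt (length_sq u i k))"
    by (simp add: log_Omega_def Omega_def edge_length_exp)
  show ?thesis
  proof
    assume "u \<in> log_Omega"
    note L' = this[unfolded L, rule_format]
    show "\<forall>i j k. {i, j, k} \<in> F \<longrightarrow> 0 < heron (length_sq u j k) (length_sq u i k) (length_sq u i j)"
    proof (intro allI impI)
      fix i j k assume f: "{i, j, k} \<in> F"
      then have g: "{j, i, k} \<in> F" "{k, i, j} \<in> F" by (simp_all add: insert_commute)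
      show "0 < heron (length_sq u j k) (length_sq u i k) (length_sq u i j)"
        unfolding iff[OF f] using L'[OF f] L'[OF g(1)] L'[OF g(2)]
        by (simp add: length_sq_commute[of u k] length_sq_commute[of u j i] add_ac)
    qed
  next
    assume "\<forall>i j k. {i, j, k} \<in> F \<longrightarrow> 0 < heron (length_sq u j k) (length_sq u i k) (length_sq u i j)"
    then show "u \<in> log_Omega"
      unfolding L using iff by (simp add: add_ac)
  qed
qed

lemma log_curvature_nth:
  "log_curvature u $ i = 2 * pi - 1 / 2 * (\<Sum>(j, k) \<in> {(j, k). {i, j, k} \<in> F}. corner_angle u i j k)"
proof -
  have "generalized_angle (sqrt (length_sq u j k)) (sqrt (length_sq u i j)) (sqrt (length_sq u i k))
      = corner_angle u i j k" if "{i, j, k} \<in> F" for j k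
    using generalized_angle_eq_angle_sq[of "sqrt (length_sq u j k)" "sqrt (length_sq u i j)" "sqrt (length_sq u i k)"]
      length_sq_pos[OF that, of u]
    by (simp add: corner_angle_def angle_sq_commute)
  then show ?thesis
    by (simp add: log_curvature_def extended_curvature_def edge_length_exp
        cong: sum.cong_simp) (intro sum.cong, auto)
qed

lemma extended_curvature_eq_curvature:
  assumes "r \<in> Omega F I"
  shows "extended_curvature F I r = curvature F I r"
proof -
  have "generalized_angle (edge_length I r j k) (edge_length I r i j) (edge_length I r i k)
      = inner_angle (edge_length I r j k) (edge_length I r i j) (edge_length I r i k)"
    if f: "{i, j, k} \<in> F" for i j k
  proof -
    have g: "{j, i, k} \<in> F" "{k, i, j} \<in> F" using f by (simp_all add: insert_commute)
    have comm: "edge_length I r i j = edge_length I r j i" for i j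
      by (simp add: edge_length_def insert_commute mult_ac add_ac)
    note t = assms[unfolded Omega_def, THEN CollectD, THEN conjunct2, rule_format]
    show ?thesis
      using t[OF f] t[OF g(1)] t[OF g(2)]
      by (simp add: generalized_angle_def comm[of k] comm[of j i] add_ac)
  qed
  then show ?thesis
    unfolding extended_curvature_def curvature_def vec_eq_iff
    by (auto intro!: sum.cong)
qed

lemma sum_corners_rotate:
  fixes g :: "'v \<Rightarrow> 'v \<Rightarrow> 'v \<Rightarrow> real"
  shows "(\<Sum>(i, j, k) \<in> corners. g j k i) = (\<Sum>(i, j, k) \<in> corners. g i j k)"
  by (rule sum.reindex_bij_witness[where i = "\<lambda>(i, j, k). (k, i, j)" and j = "\<lambda>(i, j, k). (j, k, i)"])
    (auto simp: corners_def insert_commute)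

lemma face_angles_eq:
  "face_angles w u (i, j, k) = w$i * corner_angle u i j k + w$j * corner_angle u j k i + w$k * corner_angle u k i j"
proof -
  have "corner_angle u j k i = angle_sq (length_sq u i k) (length_sq u j k) (length_sq u i j)"
    by (simp only: corner_angle_def length_sq_commute[of u k i] length_sq_commute[of u j i]
        angle_sq_commute[of "length_sq u i k" "length_sq u i j" "length_sq u j k"])
  moreover have "corner_angle u k i j = angle_sq (length_sq u i j) (length_sq u j k) (length_sq u i k)"
    by (simp only: corner_angle_def length_sq_commute[of u k i] length_sq_commute[of u k j])
  ultimately show ?thesis
    by (simp add: face_angles_def weighted_angles_def Let_def corner_angle_def flip: length_sq_def)
qed

text \<open>Pairing the curvature with \<open>w\<close> collects the angles by faces. Each face contributes to six
elements of \<open>corners\<close>, whence the factor \<open>1 / 6\<close>.\<close>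

lemma inner_log_curvature:
  "w \<bullet> log_curvature u = 2 * pi * (\<Sum>i\<in>UNIV. w$i) - 1 / 6 * (\<Sum>c\<in>corners. face_angles w u c)"
proof -
  define g where "g i j k = w$i * corner_angle u i j k" for i j k
  have corners: "corners = (SIGMA i:UNIV. {(j, k). {i, j, k} \<in> F})"
    by (auto simp: corners_def)
  have "(\<Sum>c\<in>corners. face_angles w u c) = (\<Sum>(i, j, k)\<in>corners. g i j k + g j k i + g k i j)"
    by (intro sum.cong) (auto simp: face_angles_eq g_def)
  also have "\<dots> = (\<Sum>(i, j, k)\<in>corners. g i j k) + (\<Sum>(i, j, k)\<in>corners. g j k i) + (\<Sum>(i, j, k)\<in>corners. g k i j)"
    by (simp add: sum.distrib split_def)
  also have "\<dots> = 3 * (\<Sum>(i, j, k)\<in>corners. g i j k)"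
    using sum_corners_rotate[of g] sum_corners_rotate[of "\<lambda>i j k. g j k i"] by simp
  also have "(\<Sum>(i, j, k)\<in>corners. g i j k) = (\<Sum>i\<in>UNIV. w$i * (\<Sum>(j, k) \<in> {(j, k). {i, j, k} \<in> F}. corner_angle u i j k))"
    unfolding corners g_def by (simp add: sum_distrib_left split_def) (subst sum.Sigma, auto simp: split_def)
  finally have "1 / 6 * (\<Sum>c\<in>corners. face_angles w u c)
     = 1 / 2 * (\<Sum>i\<in>UNIV. w$i * (\<Sum>(j, k) \<in> {(j, k). {i, j, k} \<in> F}. corner_angle u i j k))" by simp
  then show ?thesis
    unfolding inner_vec_def log_curvature_nth
    by (simp add: right_diff_distrib sum_subtractf sum_distrib_left sum_distrib_right mult_ac)
qed

lemma face_angles_ones: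
  assumes "c \<in> corners"
  shows "face_angles 1 u c = pi"
proof -
  obtain i j k where c: "c = (i, j, k)" "{i, j, k} \<in> F"
    using assms by (auto simp: corners_def)
  show ?thesis
    using angle_sum_pi[OF length_sq_pos[OF c(2), of u]]
    by (simp add: c face_angles_def weighted_angles_def Let_def flip: length_sq_def)
qed

text \<open>A combinatorial form of the Gauss-Bonnet theorem: the total curvature is \<open>2 \<pi>\<close> times the number
of vertices minus \<open>\<pi>\<close> times the number of faces, for degenerate triangles as well.\<close>

lemma sum_log_curvature: "(\<Sum>i\<in>UNIV. log_curvature u $ i) = (\<Sum>i\<in>UNIV. log_curvature v $ i)"
proof -
  have "(\<Sum>i\<in>UNIV. log_curvature u $ i) = 1 \<bullet> log_curvature u" for u
    by (simp add: inner_vec_def)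
  moreover have "(\<Sum>c\<in>corners. face_angles 1 u c) = (\<Sum>c\<in>corners. face_angles 1 v c)"
    using face_angles_ones by (intro sum.cong) auto
  ultimately show ?thesis by (simp add: inner_log_curvature)
qed

text \<open>By \<open>inner_log_curvature\<close> this is a sum of inequalities for the single faces.\<close>

lemma log_curvature_monotone: "0 \<le> (u - v) \<bullet> (log_curvature u - log_curvature v)"
proof -
  have "(\<Sum>c\<in>corners. face_angles (u - v) u c) \<le> (\<Sum>c\<in>corners. face_angles (u - v) v c)"
  proof (rule sum_mono)
    fix c assume "c \<in> corners"
    then obtain i j k where c: "c = (i, j, k)" "{i, j, k} \<in> F" by (auto simp: corners_def)
    show "face_angles (u - v) u c \<le> face_angles (u - v) v c"
      using weighted_angles_decreasing[OF I_corner[OF c(2)], of "v$i" "(u - v)$i" "v$j" "(u - v)$j" "v$k" "(u - v)$k"]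
      by (simp add: c face_angles_def)
  qed
  then show ?thesis by (simp add: inner_diff_right inner_log_curvature)
qed

lemma continuous_on_length_sq [continuous_intros]: "continuous_on S (\<lambda>u. length_sq u i j)"
  unfolding length_sq_def by (intro continuous_intros)

lemma continuous_log_curvature: "continuous_on UNIV log_curvature"
proof -
  have "continuous_on UNIV (\<lambda>u. corner_angle u i j k)" if "{i, j, k} \<in> F" for i j k
    unfolding corner_angle_def using length_sq_pos[OF that] by (intro continuous_intros) auto
  then have "continuous_on UNIV (\<lambda>u. log_curvature u $ i)" for i
    unfolding log_curvature_nth split_def by (intro continuous_intros) auto
  then have "continuous_on UNIV (\<lambda>u. \<chi> i. log_curvature u $ i)"
    by (intro continuous_on_vec_lambda)
  then show ?thesis by simp
qed

lemma bounded_log_curvature: obtains B where "\<And>u. norm (log_curvature u) \<le> B"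
proof
  fix u
  show "norm (log_curvature u) \<le> (\<Sum>i\<in>(UNIV::'v set). 2 * pi + 1 / 2 * (\<Sum>(j, k) \<in> {(j, k). {i, j, k} \<in> F}. pi))"
  proof (rule order_trans[OF norm_le_l1_cart sum_mono])
    fix i
    let ?P = "{(j, k). {i, j, k} \<in> F}"
    have b: "0 \<le> corner_angle u i j k" "corner_angle u i j k \<le> pi" for j k
      by (auto simp: corner_angle_def angle_sq_def intro!: arccos_lbound arccos_ubound)
    have "0 \<le> (\<Sum>(j, k) \<in> ?P. corner_angle u i j k)"
      using b by (intro sum_nonneg) auto
    moreover have "(\<Sum>(j, k) \<in> ?P. corner_angle u i j k) \<le> (\<Sum>(j, k) \<in> ?P. pi)"
      using b by (intro sum_mono) auto
    ultimately show "\<bar>log_curvature u $ i\<bar> \<le> 2 * pi + 1 / 2 * (\<Sum>(j, k) \<in> ?P. pi)"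
      unfolding log_curvature_nth using pi_gt_zero by linarith
  qed
qed

lemma length_sq_shift: "length_sq (u + k *\<^sub>R 1) i j = (exp k)\<^sup>2 * length_sq u i j"
  by (simp add: length_sq_def side_sq_def exp_add power2_eq_square algebra_simps)

lemma log_Omega_shift: "u \<in> log_Omega \<Longrightarrow> u + k *\<^sub>R 1 \<in> log_Omega"
  by (simp add: log_Omega_iff length_sq_shift heron_scale)

lemma log_curvature_shift: "log_curvature (u + k *\<^sub>R 1) = log_curvature u"
  by (simp add: vec_eq_iff log_curvature_nth corner_angle_def length_sq_shift angle_sq_scale)

lemma log_curvature_ln:
  assumes "\<forall>i. 0 < r$i"
  shows "log_curvature (\<chi> i. ln (r$i)) = extended_curvature F I r"
  using assms by (simp add: log_curvature_def)

section \<open>Coercivity of the curvature map\<close>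

lemma open_log_Omega: "open log_Omega"
proof -
  have "log_Omega = (\<Inter>(i, j, k)\<in>corners. {u. 0 < heron (length_sq u j k) (length_sq u i k) (length_sq u i j)})"
    by (auto simp: log_Omega_iff corners_def)
  moreover have "open {u. 0 < heron (length_sq u j k) (length_sq u i k) (length_sq u i j)}" for i j k
    unfolding heron_def by (intro open_Collect_less continuous_intros)
  ultimately show ?thesis by (auto intro!: open_INT)
qed

lemma face_dissipation_nonneg:
  assumes "u \<in> log_Omega" "c \<in> corners"
  shows "0 \<le> face_dissipation w u c"
proof -
  obtain i j k where c: "c = (i, j, k)" "{i, j, k} \<in> F" using assms by (auto simp: corners_def)
  then have "0 < heron (length_sq u j k) (length_sq u i k) (length_sq u i j)"
    using assms by (simp add: log_Omega_iff)
  then show ?thesis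
    unfolding c face_dissipation_def length_sq_def
    using I_corner[OF c(2)] by (auto intro!: dissipation_nonneg)
qed

text \<open>If the dissipation vanishes on every face, then \<open>w\<close> is constant on every face, hence constant,
and a constant vector with vanishing sum is zero.\<close>

lemma total_dissipation_pos:
  assumes u: "u \<in> log_Omega" and w: "w \<noteq> 0" "(\<Sum>i\<in>UNIV. w$i) = 0"
  shows "0 < (\<Sum>c\<in>corners. face_dissipation w u c)"
proof (rule ccontr)
  assume "\<not> ?thesis"
  then have "(\<Sum>c\<in>corners. face_dissipation w u c) = 0"
    using sum_nonneg[of corners "face_dissipation w u"] face_dissipation_nonneg[OF u] by fastforce
  then have zero: "face_dissipation w u c = 0" if "c \<in> corners" for c
    using sum_nonneg_eq_0_iff[OF finite_corners, of "face_dissipation w u"] face_dissipation_nonneg[OF u] that by blast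
  have "w$i = w$j" for i j
  proof (rule locally_constant)
    fix i j k assume f: "{i, j, k} \<in> F"
    show "w$i = w$j"
    proof (rule ccontr)
      assume "w$i \<noteq> w$j"
      moreover have "0 < heron (length_sq u j k) (length_sq u i k) (length_sq u i j)"
        using u f by (simp add: log_Omega_iff)
      ultimately have "0 < face_dissipation w u (i, j, k)"
        unfolding face_dissipation_def length_sq_def
        using I_corner[OF f] by (auto intro!: dissipation_pos)
      then show False using zero f by (simp add: corners_def)
    qed
  qed
  then have eq: "w$j = w$i" for i j by blast
  have "w$i = 0" for i
  proof -
    have "(\<Sum>j\<in>UNIV. w$j) = (\<Sum>j\<in>(UNIV::'v set). w$i)" by (intro sum.cong eq) simp
    then show ?thesis using w(2) by simp
  qed
  then show False using w(1) by (simp add: vec_eq_iff)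
qed

lemma face_angles_has_derivative:
  assumes "u + t *\<^sub>R w \<in> log_Omega" "c \<in> corners"
  shows "((\<lambda>t. face_angles w (u + t *\<^sub>R w) c) has_real_derivative - face_dissipation w (u + t *\<^sub>R w) c) (at t)"
proof -
  obtain i j k where c: "c = (i, j, k)" "{i, j, k} \<in> F" using assms by (auto simp: corners_def)
  then have "0 < heron (length_sq (u + t *\<^sub>R w) j k) (length_sq (u + t *\<^sub>R w) i k) (length_sq (u + t *\<^sub>R w) i j)"
    using assms by (simp add: log_Omega_iff)
  then show ?thesis
    unfolding c face_angles_def face_dissipation_def length_sq_def
    using weighted_angles_has_derivative[OF I_corner[OF c(2)]] by simp
qed

lemma continuous_total_dissipation:
  "continuous_on (log_Omega \<times> UNIV) (\<lambda>(u, w). \<Sum>c\<in>corners. face_dissipation w u c)"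
  unfolding split_def
proof (rule continuous_on_sum)
  fix c assume "c \<in> corners"
  then obtain i j k where c: "c = (i, j, k)" "{i, j, k} \<in> F" by (auto simp: corners_def)
  show "continuous_on (log_Omega \<times> UNIV) (\<lambda>p. face_dissipation (snd p) (fst p) c)"
    unfolding c face_dissipation_def split
    using c(2) I_corner[OF c(2)]
    by (intro continuous_on_dissipation continuous_intros) (auto simp: log_Omega_iff length_sq_def)
qed

text \<open>The dissipation is continuous and positive on the compact set of pairs of a point near \<open>v\<close> and a
unit vector with vanishing sum, so it has a positive lower bound there. The mean value theorem
along the segment from \<open>v\<close> to \<open>v + w\<close> turns the bound into the claim.\<close>

lemma coercive_near:
  assumes v: "v \<in> log_Omega"
  obtains \<delta> c where "0 < \<delta>" "0 < c"
    "\<And>w. (\<Sum>i\<in>UNIV. w$i) = 0 \<Longrightarrow> norm w \<le> \<delta> \<Longrightarrow>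
       c * (norm w)\<^sup>2 \<le> w \<bullet> (log_curvature (v + w) - log_curvature v)"
proof -
  obtain \<delta> where \<delta>: "0 < \<delta>" "cball v \<delta> \<subseteq> log_Omega"
    using open_log_Omega v by (meson open_contains_cball)
  define U where "U = {w::real^'v. norm w = 1 \<and> (\<Sum>i\<in>UNIV. w$i) = 0}"
  define D where "D = (\<lambda>(u, w). \<Sum>c\<in>corners. face_dissipation w u c)"
  have "U = sphere 0 1 \<inter> {w. (\<Sum>i\<in>UNIV. w$i) = 0}" by (auto simp: U_def)
  moreover have "closed {w::real^'v. (\<Sum>i\<in>UNIV. w$i) = 0}"
    by (intro closed_Collect_eq continuous_intros)
  ultimately have "compact U" by (simp add: compact_Int_closed)
  then have comp: "compact (cball v \<delta> \<times> U)" by (intro compact_Times) auto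
  have cont: "continuous_on (cball v \<delta> \<times> U) D"
    unfolding D_def using \<delta> by (intro continuous_on_subset[OF continuous_total_dissipation]) auto
  have pos: "0 < D (u, w)" if "u \<in> cball v \<delta>" "w \<in> U" for u w
    unfolding D_def using that \<delta> by (auto simp: U_def intro!: total_dissipation_pos)
  obtain c where c: "0 < c" "\<And>u w. u \<in> cball v \<delta> \<Longrightarrow> w \<in> U \<Longrightarrow> c \<le> D (u, w)"
  proof (cases "U = {}")
    case True
    then show ?thesis using that[of 1] by auto
  next
    case False
    then have "cball v \<delta> \<times> U \<noteq> {}" using \<delta> by auto
    from continuous_attains_inf[OF comp this cont] obtain p
      where p: "p \<in> cball v \<delta> \<times> U" "\<forall>x\<in>cball v \<delta> \<times> U. D p \<le> D x" by blast
    show ?thesis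
    proof (rule that)
      show "0 < D p" using p(1) pos[of "fst p" "snd p"] by (auto simp: mem_Times_iff)
    qed (use p(2) in auto)
  qed
  have "c / 6 * (norm w)\<^sup>2 \<le> w \<bullet> (log_curvature (v + w) - log_curvature v)"
    if w: "(\<Sum>i\<in>UNIV. w$i) = 0" "norm w \<le> \<delta>" for w
  proof (cases "w = 0")
    case False
    define n where "n = norm w"
    define e where "e = w /\<^sub>R n"
    have n: "0 < n" "n \<le> \<delta>" using False w by (auto simp: n_def)
    have we: "w = n *\<^sub>R e" using n by (simp add: e_def)
    have ne: "norm e = 1" using n by (simp add: e_def n_def)
    have se: "(\<Sum>i\<in>UNIV. e$i) = 0" using w(1) by (simp add: e_def flip: sum_distrib_left)
    define f where "f t = (\<Sum>c\<in>corners. face_angles e (v + t *\<^sub>R e) c)" for t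
    have der: "(f has_real_derivative - D (v + t *\<^sub>R e, e)) (at t) \<and> c \<le> D (v + t *\<^sub>R e, e)"
      if "0 \<le> t" "t \<le> n" for t
    proof -
      have in_ball: "v + t *\<^sub>R e \<in> cball v \<delta>" using that n ne by (simp add: dist_norm)
      then have "v + t *\<^sub>R e \<in> log_Omega" using \<delta> by blast
      then have "(f has_real_derivative (\<Sum>c\<in>corners. - face_dissipation e (v + t *\<^sub>R e) c)) (at t)"
        unfolding f_def by (intro DERIV_sum face_angles_has_derivative) 
      then show ?thesis
        using c(2)[OF in_ball, of e] ne se by (simp add: D_def U_def sum_negf)
    qed
    have "\<exists>t. 0 < t \<and> t < n \<and> f n - f 0 = (n - 0) * - D (v + t *\<^sub>R e, e)"
      by (rule MVT2) (use n der in auto)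
    then obtain t where t: "0 \<le> t" "t \<le> n" "f n - f 0 = (n - 0) * - D (v + t *\<^sub>R e, e)"
      by (meson less_imp_le)
    have "n * c \<le> n * D (v + t *\<^sub>R e, e)"
      using der[of t] t n by (intro mult_left_mono) auto
    then have "n * c \<le> f 0 - f n" using t(3) by simp
    moreover have "e \<bullet> (log_curvature (v + w) - log_curvature v) = 1 / 6 * (f 0 - f n)"
      by (simp add: inner_diff_right inner_log_curvature f_def we)
    ultimately have "n * c / 6 \<le> e \<bullet> (log_curvature (v + w) - log_curvature v)" by simp
    then have "n * (n * c / 6) \<le> n * (e \<bullet> (log_curvature (v + w) - log_curvature v))"
      using n by (intro mult_left_mono) auto
    also have "\<dots> = w \<bullet> (log_curvature (v + w) - log_curvature v)"
      by (subst (2) we) simp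
    finally show ?thesis by (simp add: n_def power2_eq_square mult_ac)
  qed simp
  then show thesis using that[of \<delta> "c / 6"] \<delta> c by simp
qed

text \<open>Outside the ball of \<open>coercive_near\<close> the point \<open>v + w\<close> may be degenerate. By monotonicity,
\<open>w \<bullet> K (v + k w)\<close> does not decrease with \<open>k\<close>, so the bound from the boundary of the ball persists
along the ray; it is then linear in \<open>\<bar>w\<bar>\<close>, which suffices on bounded sets.\<close>

lemma coercive:
  assumes v: "v \<in> log_Omega"
  obtains c where "0 < c"
    "\<And>w. (\<Sum>i\<in>UNIV. w$i) = 0 \<Longrightarrow> norm w \<le> R \<Longrightarrow>
       c * (norm w)\<^sup>2 \<le> w \<bullet> (log_curvature (v + w) - log_curvature v)"
proof -
  obtain \<delta> c where \<delta>: "0 < \<delta>" and c: "0 < c"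
    and near: "\<And>w. (\<Sum>i\<in>UNIV. w$i) = 0 \<Longrightarrow> norm w \<le> \<delta> \<Longrightarrow>
       c * (norm w)\<^sup>2 \<le> w \<bullet> (log_curvature (v + w) - log_curvature v)"
    using coercive_near[OF v] by metis
  define R' where "R' = max R \<delta>"
  have R': "0 < R'" "\<delta> \<le> R'" "R \<le> R'" using \<delta> by (auto simp: R'_def)
  show thesis
  proof (rule that[of "c * \<delta> / R'"])
    show "0 < c * \<delta> / R'" using c \<delta> R' by simp
    fix w :: "real^'v" assume w: "(\<Sum>i\<in>UNIV. w$i) = 0" "norm w \<le> R"
    show "c * \<delta> / R' * (norm w)\<^sup>2 \<le> w \<bullet> (log_curvature (v + w) - log_curvature v)"
    proof (cases "norm w \<le> \<delta>")
      case True
      have "c * \<delta> / R' \<le> c" using c R' by (simp add: divide_le_eq mult_left_mono)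
      then have "c * \<delta> / R' * (norm w)\<^sup>2 \<le> c * (norm w)\<^sup>2" by (rule mult_right_mono) simp
      then show ?thesis using near[OF w(1) True] by linarith
    next
      case False
      define k where "k = \<delta> / norm w"
      have "0 < norm w" using False \<delta> by linarith
      then have k: "0 < k" "k < 1" "k * norm w = \<delta>" using False \<delta> by (auto simp: k_def)
      define x where "x = k *\<^sub>R w"
      have x: "(\<Sum>i\<in>UNIV. x$i) = 0" "norm x = \<delta>"
        using w(1) k by (simp_all add: x_def flip: sum_distrib_left)
      have "0 \<le> ((v + w) - (v + x)) \<bullet> (log_curvature (v + w) - log_curvature (v + x))"
        by (rule log_curvature_monotone)
      also have "(v + w) - (v + x) = (1 - k) *\<^sub>R w" by (simp add: x_def algebra_simps)
      finally have far: "0 \<le> w \<bullet> (log_curvature (v + w) - log_curvature (v + x))"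
        using k by (simp add: zero_le_mult_iff)
      have "c * \<delta>\<^sup>2 \<le> k * (w \<bullet> (log_curvature (v + x) - log_curvature v))"
        using near[OF x(1)] x(2) by (simp add: x_def)
      also have "\<dots> \<le> k * (w \<bullet> (log_curvature (v + w) - log_curvature v))"
        using far k by (simp add: inner_diff_right)
      finally have "c * \<delta>\<^sup>2 / k \<le> w \<bullet> (log_curvature (v + w) - log_curvature v)"
        using k by (simp add: divide_le_eq mult_ac)
      moreover have "c * \<delta>\<^sup>2 / k = c * \<delta> * norm w"
        using k \<delta> False by (simp add: k_def power2_eq_square)
      moreover have "c * \<delta> / R' * (norm w)\<^sup>2 \<le> c * \<delta> * norm w"
      proof -
        have "norm w * norm w \<le> R' * norm w" using w R' by (intro mult_right_mono) auto
        then have "c * \<delta> * (norm w * norm w) \<le> c * \<delta> * (R' * norm w)"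
          using c \<delta> by (intro mult_left_mono) auto
        then show ?thesis using R' by (simp add: power2_eq_square divide_le_eq mult_ac)
      qed
      ultimately show ?thesis by linarith
    qed
  qed
qed

end

section \<open>The flow\<close>

lemma has_vector_derivative_nth_iff:
  fixes f :: "real \<Rightarrow> real^'v::finite"
  shows "(f has_vector_derivative f') (at t within S) \<longleftrightarrow>
     (\<forall>i. ((\<lambda>t. f t $ i) has_real_derivative f' $ i) (at t within S))"
  unfolding has_vector_derivative_def has_derivative_componentwise_within[of f] Basis_vec_def
  by (simp add: inner_axis has_field_derivative_def mult_commute_abs)

lemma DERIV_fun_exp_within:
  "(g has_real_derivative m) (at x within S) \<Longrightarrow>
   ((\<lambda>x. exp (g x)) has_real_derivative exp (g x) * m) (at x within S)"
  by (auto intro!: derivative_eq_intros)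

lemma exp_diff_le:
  fixes x y m :: real
  assumes "x \<le> m" "y \<le> m"
  shows "\<bar>exp x - exp y\<bar> \<le> exp m * \<bar>x - y\<bar>"
proof -
  have le: "exp x - exp y \<le> exp m * \<bar>x - y\<bar>" if "y \<le> x" "x \<le> m" for x y :: real
  proof -
    have "1 - exp (y - x) \<le> x - y" using exp_ge_add_one_self[of "y - x"] by linarith
    then have "exp x * (1 - exp (y - x)) \<le> exp x * (x - y)" by (intro mult_left_mono) auto
    also have "\<dots> \<le> exp m * (x - y)" using that by (intro mult_right_mono) auto
    finally show ?thesis using that by (simp add: right_diff_distrib flip: exp_add)
  qed
  show ?thesis using le[of y x] le[of x y] assms by (cases "y \<le> x") auto
qed

context inversive_distance_surface
begin

text \<open>The three conclusions use monotonicity in three ways: for the existence of a global solution in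
logarithmic coordinates, for its coincidence with the given one, and, sharpened to coercivity,
for its convergence.\<close>

theorem extended_flow_exists:
  assumes r: "flow_solution (curvature F I) (Omega F I) Kbar T r" and "0 < T"
  obtains \<rho> where "extended_flow_solution F I Kbar \<rho>"
    and "\<And>t. t \<in> time_interval T \<Longrightarrow> \<rho> t = r t"
    and "\<And>rbar. rbar \<in> Omega F I \<Longrightarrow> curvature F I rbar = Kbar \<Longrightarrow>
           \<exists>s > 0. converges_exponentially \<rho> (s *\<^sub>R rbar)"
proof -
  define X where "X u = Kbar - log_curvature u" for u
  have cont: "continuous_on UNIV X"
    unfolding X_def by (intro continuous_intros continuous_log_curvature)
  obtain B where B: "\<And>u. norm (log_curvature u) \<le> B" using bounded_log_curvature by blast
  have bdd: "norm (X u) \<le> norm Kbar + B" for u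
    unfolding X_def using norm_triangle_ineq4[of Kbar "log_curvature u"] B[of u] by linarith
  have mono: "(x - y) \<bullet> (X x - X y) \<le> 0" for x y
    using log_curvature_monotone[of x y] by (simp add: X_def inner_diff_right)
  define a :: "real^'v" where "a = (\<chi> i. ln (r 0 $ i))"
  obtain u where u0: "u 0 = a"
    and u: "\<And>t. 0 \<le> t \<Longrightarrow> (u has_vector_derivative X (u t)) (at t within {0..})"
    using monotone_flow_exists[OF cont bdd mono] by metis
  define \<rho> where "\<rho> t = (\<chi> i. exp (u t $ i))" for t
  define J where "J = time_interval T"
  have J0: "0 \<in> J" using \<open>0 < T\<close> by (simp add: J_def time_interval_def zero_ereal_def)
  have J: "{0..t} \<subseteq> J" "0 \<le> t" if "t \<in> J" for t
    using that by (auto simp: J_def time_interval_def intro: le_less_trans[of _ "ereal t"])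
  have rJ: "r t \<in> Omega F I" "\<forall>i. 0 < r t $ i" if "t \<in> J" for t
    using r that by (auto simp: flow_solution_def J_def Omega_def)
  have sol: "extended_flow_solution F I Kbar \<rho>"
  proof -
    have "(\<rho> has_vector_derivative (\<chi> i. (Kbar$i - extended_curvature F I (\<rho> t)$i) * \<rho> t$i)) (at t within {0..})"
      if "0 \<le> t" for t
      unfolding has_vector_derivative_nth_iff
    proof
      fix i
      have "((\<lambda>t. u t $ i) has_real_derivative X (u t) $ i) (at t within {0..})"
        using u[OF that] by (simp add: has_vector_derivative_nth_iff)
      then have "((\<lambda>t. exp (u t $ i)) has_real_derivative exp (u t $ i) * X (u t) $ i) (at t within {0..})"
        by (rule DERIV_fun_exp_within)
      then show "((\<lambda>t. \<rho> t $ i) has_real_derivative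
          (\<chi> i. (Kbar$i - extended_curvature F I (\<rho> t)$i) * \<rho> t$i) $ i) (at t within {0..})"
        by (simp add: \<rho>_def X_def log_curvature_def mult.commute)
    qed
    moreover have "time_interval \<infinity> = {0..}" by (auto simp: time_interval_def)
    ultimately show ?thesis
      by (auto simp: extended_flow_solution_def flow_solution_def \<rho>_def)
  qed
  have agree: "\<rho> t = r t" if t: "t \<in> J" for t
  proof -
    define v where "v t = (\<chi> i. ln (r t $ i))" for t
    have v: "(v has_vector_derivative X (v t)) (at t within J)" if t: "t \<in> J" for t
      unfolding has_vector_derivative_nth_iff
    proof
      fix i
      have "((\<lambda>t. r t $ i) has_real_derivative (Kbar$i - curvature F I (r t)$i) * r t$i) (at t within J)"
        using r t by (simp add: flow_solution_def has_vector_derivative_nth_iff J_def)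
      then have "((\<lambda>t. ln (r t $ i)) has_real_derivative
          1 / (r t $ i) * ((Kbar$i - curvature F I (r t)$i) * r t$i)) (at t within J)"
        using rJ[OF t] by (intro DERIV_chain2[OF DERIV_ln_divide]) auto
      moreover have "X (v t) $ i = Kbar$i - curvature F I (r t)$i"
        using log_curvature_ln[OF rJ(2)[OF t]] extended_curvature_eq_curvature[OF rJ(1)[OF t]]
        by (simp add: X_def v_def)
      ultimately show "((\<lambda>t. v t $ i) has_real_derivative X (v t) $ i) (at t within J)"
        using rJ(2)[OF t, rule_format, of i] by (simp add: v_def)
    qed
    have "(norm (u t - v t))\<^sup>2 \<le> (norm (u 0 - v 0))\<^sup>2 * exp (- 0 * t)"
    proof (rule exponential_decay[of J])
      fix s assume s: "s \<in> J"
      have "(u has_vector_derivative X (u s)) (at s within J)"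
        using u[OF J(2)[OF s]] by (rule has_vector_derivative_within_subset) (auto dest: J)
      then show "((\<lambda>t. (norm (u t - v t))\<^sup>2) has_real_derivative 2 * ((u s - v s) \<bullet> (X (u s) - X (v s)))) (at s within J)"
        using v[OF s] by (intro has_derivative_norm_sq has_vector_derivative_diff)
      show "2 * ((u s - v s) \<bullet> (X (u s) - X (v s))) \<le> - 0 * (norm (u s - v s))\<^sup>2"
        using mono[of "u s" "v s"] by simp
    qed (use J t in auto)
    then have "u t = v t" by (simp add: u0 a_def v_def)
    then show ?thesis
      using rJ(2)[OF t] by (simp add: \<rho>_def v_def vec_eq_iff)
  qed
  have conv: "\<exists>s > 0. converges_exponentially \<rho> (s *\<^sub>R rbar)"
    if rbar: "rbar \<in> Omega F I" "curvature F I rbar = Kbar" for rbar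
  proof -
    define b :: "real^'v" where "b = (\<chi> i. ln (rbar $ i))"
    \<comment> \<open>The scaling of \<open>rbar\<close> for which its logarithm has the same coordinate sum as the start.\<close>
    define k where "k = ((\<Sum>i\<in>UNIV. a$i) - (\<Sum>i\<in>UNIV. b$i)) / real CARD('v)"
    define v where "v = b + k *\<^sub>R 1"
    have rpos: "\<forall>i. 0 < rbar $ i" using rbar by (simp add: Omega_def)
    then have "(\<chi> i. exp (b $ i)) = rbar" by (simp add: b_def vec_eq_iff)
    then have b: "b \<in> log_Omega" "log_curvature b = Kbar"
      using rbar extended_curvature_eq_curvature[OF rbar(1)]
      by (simp_all add: log_Omega_def log_curvature_def)
    then have v: "v \<in> log_Omega" "log_curvature v = Kbar"
      by (simp_all add: v_def log_Omega_shift log_curvature_shift)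
    have v_exp: "exp (v $ i) = exp k * rbar $ i" for i
      using rpos by (simp add: v_def b_def exp_add)
    define w where "w t = u t - v" for t
    have w: "(w has_vector_derivative X (u t)) (at t within {0..})" if "0 \<le> t" for t
      unfolding w_def using has_vector_derivative_diff[OF u[OF that] has_vector_derivative_const] by simp
    have sum_w: "(\<Sum>i\<in>UNIV. w t $ i) = 0" if "0 \<le> t" for t
    proof -
      have "((\<lambda>t. \<Sum>i\<in>UNIV. w t $ i) has_real_derivative 0) (at t within {0..})" if "t \<in> {0..}" for t
      proof -
        have "((\<lambda>t. \<Sum>i\<in>UNIV. w t $ i) has_real_derivative (\<Sum>i\<in>UNIV. X (u t) $ i)) (at t within {0..})"
          using w that by (intro DERIV_sum) (simp add: has_vector_derivative_nth_iff)
        moreover have "(\<Sum>i\<in>UNIV. X (u t) $ i) = 0"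
          using sum_log_curvature[of "u t" v] v(2) by (simp add: X_def sum_subtractf)
        ultimately show ?thesis by simp
      qed
      then obtain c where "\<forall>t\<in>{0..}. (\<Sum>i\<in>UNIV. w t $ i) = c"
        using has_field_derivative_zero_constant[of "{0..}" "\<lambda>t. \<Sum>i\<in>UNIV. w t $ i"] by auto
      then have "(\<Sum>i\<in>UNIV. w t $ i) = (\<Sum>i\<in>UNIV. w 0 $ i)" using that by simp
      also have "\<dots> = 0"
        by (simp add: w_def u0 v_def sum_subtractf sum.distrib k_def)
      finally show ?thesis .
    qed
    have der: "((\<lambda>t. (norm (w t))\<^sup>2) has_real_derivative 2 * (w t \<bullet> X (u t))) (at t within {0..})"
      if "t \<in> {0..}" for t
      using w that by (intro has_derivative_norm_sq) auto
    have X_w: "w t \<bullet> X (u t) = - (w t \<bullet> (log_curvature (v + w t) - log_curvature v))" for t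
      using v by (simp add: X_def w_def inner_diff_right)
    define R where "R = norm (w 0)"
    have bound: "norm (w t) \<le> R" if "0 \<le> t" for t
    proof -
      have "(norm (w t))\<^sup>2 \<le> (norm (w 0))\<^sup>2 * exp (- 0 * t)"
        by (rule exponential_decay[OF der])
          (use that log_curvature_monotone[of "v + w _" v] in \<open>auto simp: X_w\<close>)
      then show ?thesis by (simp add: R_def)
    qed
    obtain c where c: "0 < c" "\<And>w. (\<Sum>i\<in>UNIV. w$i) = 0 \<Longrightarrow> norm w \<le> R \<Longrightarrow>
       c * (norm w)\<^sup>2 \<le> w \<bullet> (log_curvature (v + w) - log_curvature v)"
      using coercive[OF v(1)] by metis
    have decay: "norm (w t) \<le> R * exp (- c * t)" if "0 \<le> t" for t
    proof -
      have "(norm (w t))\<^sup>2 \<le> (norm (w 0))\<^sup>2 * exp (- (2 * c) * t)"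
      proof (rule exponential_decay[OF der])
        fix t :: real assume "t \<in> {0..}"
        then show "2 * (w t \<bullet> X (u t)) \<le> - (2 * c) * (norm (w t))\<^sup>2"
          using c(2)[OF sum_w[of t] bound[of t]] by (simp add: X_w)
      qed (use that in auto)
      also have "\<dots> = (R * exp (- c * t))\<^sup>2"
        by (simp add: R_def power_mult_distrib flip: exp_double)
      finally show ?thesis
        by (rule power2_le_imp_le) (simp add: R_def)
    qed
    define m where "m = norm v + R"
    \<comment> \<open>The exponential function has Lipschitz constant \<open>exp m\<close> on the range of the coordinates; \<open>R + 1\<close> instead of \<open>R\<close> keeps the constant positive for a stationary solution.\<close>
    have "norm (\<rho> t - exp k *\<^sub>R rbar) \<le> real CARD('v) * exp m * (R + 1) * exp (- c * t)" if t: "0 \<le> t" for t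
    proof -
      have "\<bar>(\<rho> t - exp k *\<^sub>R rbar) $ i\<bar> \<le> exp m * ((R + 1) * exp (- c * t))" for i
      proof -
        have wi: "\<bar>w t $ i\<bar> \<le> norm (w t)" "\<bar>v $ i\<bar> \<le> norm v"
          using component_le_norm_cart by blast+
        have "u t $ i = w t $ i + v $ i" by (simp add: w_def)
        then have "\<bar>u t $ i\<bar> \<le> m" "\<bar>v $ i\<bar> \<le> m"
          using wi bound[OF t] norm_ge_zero[of "w t"] by (auto simp: m_def R_def abs_le_iff)
        then have "\<bar>exp (u t $ i) - exp (v $ i)\<bar> \<le> exp m * \<bar>u t $ i - v $ i\<bar>"
          by (intro exp_diff_le) auto
        also have "\<dots> \<le> exp m * ((R + 1) * exp (- c * t))"
        proof (rule mult_left_mono)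
          show "\<bar>u t $ i - v $ i\<bar> \<le> (R + 1) * exp (- c * t)"
            using wi(1) decay[OF t] exp_gt_zero[of "- c * t"] \<open>u t $ i = w t $ i + v $ i\<close>
            unfolding distrib_right by linarith
        qed simp
        finally show ?thesis by (simp add: \<rho>_def v_exp)
      qed
      then have "norm (\<rho> t - exp k *\<^sub>R rbar) \<le> (\<Sum>i\<in>(UNIV::'v set). exp m * ((R + 1) * exp (- c * t)))"
        by (intro order_trans[OF norm_le_l1_cart] sum_mono) auto
      then show ?thesis by (simp add: mult_ac)
    qed
    moreover have "0 < real CARD('v) * exp m * (R + 1)"
      by (simp add: R_def add_nonneg_pos)
    ultimately have "converges_exponentially \<rho> (exp k *\<^sub>R rbar)"
      unfolding converges_exponentially_def using c(1) by blast
    then show ?thesis by (meson exp_gt_zero)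
  qed
  show thesis using that sol agree conv by (simp add: J_def)
qed

end

section \<open>Connected surfaces\<close>

text \<open>The function extends affinely over the simplex that contains the realization. It is constant on
each face, so on the realization it has finitely many values, and connectedness leaves one.\<close>

lemma constant_on_realization_vertices:
  fixes \<phi> :: "'v::finite \<Rightarrow> real"
  assumes conn: "connected (realization F)" and cover: "\<Union>F = UNIV"
    and const: "\<And>f i j. f \<in> F \<Longrightarrow> i \<in> f \<Longrightarrow> j \<in> f \<Longrightarrow> \<phi> i = \<phi> j"
  shows "\<phi> i = \<phi> j"
proof -
  define g where "g x = (\<Sum>i\<in>UNIV. \<phi> i * x$i)" for x :: "real^'v"
  have g_axis: "g (axis i 1) = \<phi> i" for i
    by (simp add: g_def axis_def if_distrib cong: if_cong)
  have vertex: "axis i 1 \<in> realization F" for i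
  proof -
    have "i \<in> \<Union>F" unfolding cover by simp
    then obtain f where "f \<in> F" "i \<in> f" by (rule UnionE)
    then have "axis i 1 \<in> convex hull ((\<lambda>i. axis i (1::real)) ` f)" by (intro hull_inc imageI)
    then show ?thesis unfolding realization_def using \<open>f \<in> F\<close> by (rule UN_I[rotated])
  qed
  have "g x \<in> range \<phi>" if x: "x \<in> realization F" for x
  proof -
    obtain f where f: "f \<in> F" "x \<in> convex hull ((\<lambda>i. axis i 1) ` f)"
      using x by (auto simp: realization_def)
    then obtain i where i: "i \<in> f" by fastforce
    have "convex {x. g x = \<phi> i}"
      by (rule convexI) (auto simp: g_def sum.distrib distrib_left mult.left_commute
          simp flip: sum_distrib_left distrib_right)
    moreover have "(\<lambda>i. axis i 1) ` f \<subseteq> {x. g x = \<phi> i}"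
      using const[OF f(1) _ i] by (auto simp: g_axis)
    ultimately have "convex hull ((\<lambda>i. axis i 1) ` f) \<subseteq> {x. g x = \<phi> i}"
      by (intro hull_minimal)
    then show ?thesis using f by auto
  qed
  then have "finite (g ` realization F)"
    by (meson finite_subset finite_imageI finite image_subsetI)
  moreover have "continuous_on (realization F) g"
    unfolding g_def by (intro continuous_intros)
  ultimately have "g constant_on realization F"
    using continuous_finite_range_constant conn by blast
  then show ?thesis
    using vertex g_axis unfolding constant_on_def by metis
qed

theorem corollary4p4:
  fixes M :: "'m topology"
    and F :: "'v::finite set set"
    and I :: "'v set \<Rightarrow> real"
    and Kbar :: "real^'v"
    and T :: ereal
    and r :: "real \<Rightarrow> real^'v"
  assumes "closed_surface M" and "connected_space M" and "triangulates F M"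
    and "\<forall>e \<in> edges F. 0 \<le> I e"
    and "0 < T"
    and "maximal_flow_solution (curvature F I) (Omega F I) Kbar T r"
  shows "(T < \<infinity> \<longrightarrow>
            (\<exists>\<rho>. extended_flow_solution F I Kbar \<rho> \<and> (\<forall>t \<in> time_interval T. \<rho> t = r t))) \<and>
         (\<forall>rbar \<in> Omega F I. curvature F I rbar = Kbar \<longrightarrow>
            (\<exists>\<rho>. extended_flow_solution F I Kbar \<rho> \<and> (\<forall>t \<in> time_interval T. \<rho> t = r t) \<and>
                 (\<exists>s > 0. converges_exponentially \<rho> (s *\<^sub>R rbar))))"
proof -
  have tri: "\<forall>f\<in>F. card f = 3" "\<Union>F = UNIV" "top_of_set (realization F) homeomorphic_space M"
    using \<open>triangulates F M\<close> by (auto simp: triangulates_def)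
  have conn: "connected (realization F)"
    using homeomorphic_connected_space[OF tri(3)] \<open>connected_space M\<close>
    using connectedin_iff_connected[of "realization F"] by (simp add: connectedin_def)
  interpret inversive_distance_surface F I
  proof
    fix \<phi> :: "'v \<Rightarrow> real" and i j
    assume eq: "\<And>i j k. {i, j, k} \<in> F \<Longrightarrow> \<phi> i = \<phi> j"
    show "\<phi> i = \<phi> j"
    proof (rule constant_on_realization_vertices[OF conn tri(2)])
      fix f i j assume f: "f \<in> F" "i \<in> f" "j \<in> f"
      show "\<phi> i = \<phi> j"
      proof (cases "i = j")
        case False
        have "card (f - {i, j}) = 1"
          using f False tri(1) by (subst card_Diff_subset) auto
        then obtain k where "f - {i, j} = {k}" by (auto simp: card_1_singleton_iff)
        then have "f = {i, j, k}" using f by auto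
        then show ?thesis using eq f by blast
      qed simp
    qed
  qed (use tri(1) assms(4) in auto)
  have "flow_solution (curvature F I) (Omega F I) Kbar T r"
    using assms(6) by (simp add: maximal_flow_solution_def)
  then obtain \<rho> where "extended_flow_solution F I Kbar \<rho>"
    and "\<And>t. t \<in> time_interval T \<Longrightarrow> \<rho> t = r t"
    and "\<And>rbar. rbar \<in> Omega F I \<Longrightarrow> curvature F I rbar = Kbar \<Longrightarrow>
           \<exists>s > 0. converges_exponentially \<rho> (s *\<^sub>R rbar)"
    using extended_flow_exists \<open>0 < T\<close> by metis
  then show ?thesis by blast
qed

end
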